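(* Let $(W,S)$ be a Coxeter system such that $S$ admits a well-ordering. If $G$ is a locally finite subgroup of $W$, then its locally parabolic closure $LP(G)$ is locally finite. Hence $G$ is contained in a locally finite subgroup of $W$ that is locally parabolic.
   Context: A group is locally finite if each finite subset generates a finite subgroup. For a reflection subgroup $G$ (subgroup generated by reflections), $S(G)=\{s_\gamma\mid\gamma\in\Pi(G)\}$ is its canonical generating set, where $\Pi(G)$ is the set of positive roots $\gamma$ (geometric representation) with $s_\gamma\in G$ not expressible as positive linear combinations of other positive roots $\beta$ with $s_\beta\in G$. $G\le W$ is locally parabolic if it is a reflection subgroup and each finite subset of $S(G)$ is conjugate in $W$ to a subset of $S$. The locally parabolic closure $LP(X)$ of $X\subseteq W$ is the intersection of all locally parabolic subgroups containing $X$ (it is itself locally parabolic). *)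

theory Defs
  imports Complex_Main "HOL-Algebra.Algebra"
begin

definition wprod :: "('a, 'b) monoid_scheme \<Rightarrow> 'a list \<Rightarrow> 'a" where
  "wprod W u = foldr (\<lambda>x y. x \<otimes>\<^bsub>W\<^esub> y) u \<one>\<^bsub>W\<^esub>"

text \<open>Coxeter matrix entry m(s,t) = order of st in W (0 encodes infinity).\<close>
definition cox_m :: "('a, 'b) monoid_scheme \<Rightarrow> 'a \<Rightarrow> 'a \<Rightarrow> nat" where
  "cox_m W s t = group.ord W (s \<otimes>\<^bsub>W\<^esub> t)"

inductive cox_eq :: "('a, 'b) monoid_scheme \<Rightarrow> 'a set \<Rightarrow> 'a list \<Rightarrow> 'a list \<Rightarrow> bool"
  for W S where
  rel_sq: "s \<in> S \<Longrightarrow> cox_eq W S [s, s] []"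
| rel_braid: "s \<in> S \<Longrightarrow> t \<in> S \<Longrightarrow> cox_m W s t \<noteq> 0 \<Longrightarrow>
     cox_eq W S (concat (replicate (cox_m W s t) [s, t])) []"
| refl: "cox_eq W S u u"
| sym: "cox_eq W S u v \<Longrightarrow> cox_eq W S v u"
| trans: "cox_eq W S u v \<Longrightarrow> cox_eq W S v w \<Longrightarrow> cox_eq W S u w"
| ctxt: "cox_eq W S u v \<Longrightarrow> cox_eq W S (x @ u @ y) (x @ v @ y)"

definition coxeter_system :: "('a, 'b) monoid_scheme \<Rightarrow> 'a set \<Rightarrow> bool" where
  "coxeter_system W S \<longleftrightarrow> group W \<and> S \<subseteq> carrier W \<and> \<one>\<^bsub>W\<^esub> \<notin> S
     \<and> (\<forall>s\<in>S. s \<otimes>\<^bsub>W\<^esub> s = \<one>\<^bsub>W\<^esub>)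
     \<and> generate W S = carrier W
     \<and> (\<forall>u \<in> lists S. \<forall>v \<in> lists S. wprod W u = wprod W v \<longleftrightarrow> cox_eq W S u v)"

text \<open>Vectors of V = real vector space with basis (alpha_s)_{s in S} are represented as
  finitely supported functions 'a => real (support contained in S).\<close>
definition simple_root :: "'a \<Rightarrow> ('a \<Rightarrow> real)" where
  "simple_root s = (\<lambda>x. if x = s then 1 else 0)"

definition cox_B0 :: "('a, 'b) monoid_scheme \<Rightarrow> 'a \<Rightarrow> 'a \<Rightarrow> real" where
  "cox_B0 W s t = (if cox_m W s t = 0 then -1 else - cos (pi / real (cox_m W s t)))"

definition cox_B :: "('a, 'b) monoid_scheme \<Rightarrow> 'a set \<Rightarrow> ('a \<Rightarrow> real) \<Rightarrow> ('a \<Rightarrow> real) \<Rightarrow> real" where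
  "cox_B W S u v = (\<Sum>s\<in>{s\<in>S. u s \<noteq> 0}. \<Sum>t\<in>{t\<in>S. v t \<noteq> 0}. u s * v t * cox_B0 W s t)"

definition sigma_s :: "('a, 'b) monoid_scheme \<Rightarrow> 'a set \<Rightarrow> 'a \<Rightarrow> ('a \<Rightarrow> real) \<Rightarrow> ('a \<Rightarrow> real)" where
  "sigma_s W S s v = (\<lambda>x. v x - 2 * cox_B W S (simple_root s) v * simple_root s x)"

fun act_word :: "('a, 'b) monoid_scheme \<Rightarrow> 'a set \<Rightarrow> 'a list \<Rightarrow> ('a \<Rightarrow> real) \<Rightarrow> ('a \<Rightarrow> real)" where
  "act_word W S [] v = v"
| "act_word W S (s # u) v = sigma_s W S s (act_word W S u v)"

definition roots :: "('a, 'b) monoid_scheme \<Rightarrow> 'a set \<Rightarrow> ('a \<Rightarrow> real) set" where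
  "roots W S = {act_word W S u (simple_root s) | u s. u \<in> lists S \<and> s \<in> S}"

definition pos_roots :: "('a, 'b) monoid_scheme \<Rightarrow> 'a set \<Rightarrow> ('a \<Rightarrow> real) set" where
  "pos_roots W S = {\<gamma> \<in> roots W S. \<forall>x. 0 \<le> \<gamma> x}"

definition root_refl :: "('a, 'b) monoid_scheme \<Rightarrow> 'a set \<Rightarrow> ('a \<Rightarrow> real) \<Rightarrow> 'a" where
  "root_refl W S \<gamma> = (SOME r. \<exists>u s. u \<in> lists S \<and> s \<in> S \<and> \<gamma> = act_word W S u (simple_root s)
       \<and> r = wprod W u \<otimes>\<^bsub>W\<^esub> s \<otimes>\<^bsub>W\<^esub> inv\<^bsub>W\<^esub> (wprod W u))"

definition reflections :: "('a, 'b) monoid_scheme \<Rightarrow> 'a set \<Rightarrow> 'a set" where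
  "reflections W S = {w \<otimes>\<^bsub>W\<^esub> s \<otimes>\<^bsub>W\<^esub> inv\<^bsub>W\<^esub> w | w s. w \<in> carrier W \<and> s \<in> S}"

definition reflection_subgroup :: "('a, 'b) monoid_scheme \<Rightarrow> 'a set \<Rightarrow> 'a set \<Rightarrow> bool" where
  "reflection_subgroup W S G \<longleftrightarrow> (\<exists>R \<subseteq> reflections W S. G = generate W R)"

definition pos_roots_of :: "('a, 'b) monoid_scheme \<Rightarrow> 'a set \<Rightarrow> 'a set \<Rightarrow> ('a \<Rightarrow> real) set" where
  "pos_roots_of W S G = {\<gamma> \<in> pos_roots W S. root_refl W S \<gamma> \<in> G}"

definition pos_lin_comb :: "('a \<Rightarrow> real) set \<Rightarrow> ('a \<Rightarrow> real) \<Rightarrow> bool" where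
  "pos_lin_comb A \<gamma> \<longleftrightarrow> (\<exists>F c. finite F \<and> F \<noteq> {} \<and> F \<subseteq> A \<and> (\<forall>\<beta>\<in>F. 0 < c \<beta>)
       \<and> \<gamma> = (\<lambda>x. \<Sum>\<beta>\<in>F. c \<beta> * \<beta> x))"

definition Pi_G :: "('a, 'b) monoid_scheme \<Rightarrow> 'a set \<Rightarrow> 'a set \<Rightarrow> ('a \<Rightarrow> real) set" where
  "Pi_G W S G = {\<gamma> \<in> pos_roots_of W S G. \<not> pos_lin_comb (pos_roots_of W S G - {\<gamma>}) \<gamma>}"

definition canon_gens :: "('a, 'b) monoid_scheme \<Rightarrow> 'a set \<Rightarrow> 'a set \<Rightarrow> 'a set" where
  "canon_gens W S G = root_refl W S ` Pi_G W S G"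

definition locally_parabolic :: "('a, 'b) monoid_scheme \<Rightarrow> 'a set \<Rightarrow> 'a set \<Rightarrow> bool" where
  "locally_parabolic W S G \<longleftrightarrow> reflection_subgroup W S G \<and>
     (\<forall>F. finite F \<and> F \<subseteq> canon_gens W S G \<longrightarrow>
        (\<exists>w\<in>carrier W. (\<lambda>x. w \<otimes>\<^bsub>W\<^esub> x \<otimes>\<^bsub>W\<^esub> inv\<^bsub>W\<^esub> w) ` F \<subseteq> S))"

definition LP_closure :: "('a, 'b) monoid_scheme \<Rightarrow> 'a set \<Rightarrow> 'a set \<Rightarrow> 'a set" where
  "LP_closure W S Y = {g. \<forall>K. locally_parabolic W S K \<and> Y \<subseteq> K \<longrightarrow> g \<in> K}"

definition locally_finite :: "('a, 'b) monoid_scheme \<Rightarrow> 'a set \<Rightarrow> bool" where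
  "locally_finite W G \<longleftrightarrow> (\<forall>F. finite F \<and> F \<subseteq> G \<longrightarrow> finite (generate W F))"

end

theory Submission
  imports Defs
begin

text \<open>A finite subgroup of \<open>W\<close> fixes a point in the interior of the Tits cone, and the stabilizer of
  such a point is a finite parabolic subgroup. Among the fixed points, one lying on the fewest walls
  has the smallest stabilizer, so that every finite subset \<open>E\<close> of the locally finite group \<open>G\<close> has a
  finite parabolic closure, monotone in \<open>E\<close>. The directed union \<open>H\<close> of these closures is locally
  finite. It is locally parabolic because finitely many canonical generators of \<open>H\<close> lie in one of
  the closures \<open>P\<close> and are canonical generators of \<open>P\<close>, which are simultaneously conjugate to simple
  reflections. Finally \<open>LP(G) \<subseteq> H\<close>.\<close>

text \<open>\<open>S\<close> may be infinite, so \<open>V\<close> may have infinite dimension, and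
  the interior of the Tits cone is described without topology: a functional belongs to it if only
  finitely many positive roots are nonpositive there. This finiteness drives the proof. Induction on
  the number of positive roots with negative value moves a point into the dominant chamber, and an
  element of the stabilizer is determined by its effect on finitely many simple roots, whose images
  are taken from a finite set. A fixed point arises by averaging a functional that is positive on
  all positive roots: each group element makes only finitely many positive roots negative, so the
  average stays in the interior. All of this rests on the coordinates of a root having one sign,
  which is derived from the presentation. Choosing a generic fixed point replaces any study of
  intersections of parabolic subgroups.\<close>

definition lc :: "real \<Rightarrow> ('a \<Rightarrow> real) \<Rightarrow> real \<Rightarrow> ('a \<Rightarrow> real) \<Rightarrow> 'a \<Rightarrow> real" where
  "lc a u b v = (\<lambda>x. a * u x + b * v x)"

text \<open>In terms of the Chebyshev polynomials of the second kind, \<open>cheb c n = U\<^sub>n\<^sub>-\<^sub>1 (c / 2)\<close>.\<close>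

fun cheb :: "real \<Rightarrow> nat \<Rightarrow> real" where
  "cheb c 0 = 0"
| "cheb c (Suc 0) = 1"
| "cheb c (Suc (Suc n)) = c * cheb c (Suc n) - cheb c n"

lemma cheb_sin: "cheb (2 * cos \<theta>) n * sin \<theta> = sin (real n * \<theta>)"
proof (induction "2 * cos \<theta>" n rule: cheb.induct)
  case (3 n)
  have "sin (real (Suc (Suc n)) * \<theta>) + sin (real n * \<theta>) = 2 * cos \<theta> * sin (real (Suc n) * \<theta>)"
  proof -
    have 1: "real (Suc (Suc n)) * \<theta> = real (Suc n) * \<theta> + \<theta>" "real n * \<theta> = real (Suc n) * \<theta> - \<theta>"
      by (simp_all add: algebra_simps)
    show ?thesis unfolding 1 by (simp add: sin_add sin_diff)
  qed
  with 3 show ?case by (simp add: algebra_simps)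
qed auto

lemma cheb_two: "cheb 2 n = real n"
  by (induction "2::real" n rule: cheb.induct) auto

text \<open>For \<open>k\<close> at most \<open>m\<close> the angle \<open>k * pi / m\<close> stays
  in \<open>[0, pi]\<close>, where the sine is nonnegative. The value \<open>m = 0\<close> encodes
  infinite order; the coefficients then grow linearly.\<close>

lemma cheb_nonneg:
  assumes "m \<noteq> 0 \<Longrightarrow> k \<le> m" and "m \<noteq> 1"
  shows "0 \<le> cheb (if m = 0 then 2 else 2 * cos (pi / real m)) k"
proof (cases "m = 0")
  case False
  with assms have m: "m \<ge> 2" "k \<le> m" by auto
  then have "sin (pi / real m) > 0" by (intro sin_gt_zero) (auto simp: field_simps)
  moreover have "sin (real k * (pi / real m)) \<ge> 0"
    using m by (intro sin_ge_zero) (auto simp: field_simps)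
  ultimately show ?thesis using cheb_sin[of "pi / real m" k] False
    by (smt (verit) mult_neg_pos)
qed (simp add: cheb_two)

text \<open>After \<open>2 * m\<close> steps the angle has made one full turn.\<close>

lemma cheb_period:
  assumes "m \<ge> 2"
  shows "cheb (2 * cos (pi / real m)) (2 * m) = 0"
    "cheb (2 * cos (pi / real m)) (Suc (2 * m)) = 1"
proof -
  let ?t = "pi / real m"
  have s: "sin ?t > 0" using assms by (intro sin_gt_zero) (auto simp: field_simps)
  have 1: "real (2 * m) * ?t = 2 * pi" "real (Suc (2 * m)) * ?t = 2 * pi + ?t"
    using assms by (auto simp: field_simps)
  show "cheb (2 * cos ?t) (2 * m) = 0" using cheb_sin[of ?t "2 * m"] s unfolding 1 by simp
  show "cheb (2 * cos ?t) (Suc (2 * m)) = 1" using cheb_sin[of ?t "Suc (2 * m)"] s unfolding 1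
    by (simp add: sin_add)
qed

text \<open>The last letter is always \<open>t\<close> and the first depends on the parity of the
  length, since these words serve as suffixes of a word ending in \<open>t\<close>.\<close>

fun alt :: "'a \<Rightarrow> 'a \<Rightarrow> nat \<Rightarrow> 'a list" where
  "alt s t 0 = []"
| "alt s t (Suc k) = alt t s k @ [t]"

lemma length_alt [simp]: "length (alt s t k) = k"
  by (induction s t k rule: alt.induct) auto

lemma alt_in_lists: "s \<in> S \<Longrightarrow> t \<in> S \<Longrightarrow> alt s t k \<in> lists S"
  by (induction s t k rule: alt.induct) auto

lemma alt_Cons: "alt s t (Suc k) = (if even k then t else s) # alt s t k"
proof (induction k arbitrary: s t)
  case (Suc k)
  have "alt s t (Suc (Suc k)) = alt t s (Suc k) @ [t]" by simp
  also have "\<dots> = (if even k then s else t) # (alt t s k @ [t])" by (subst Suc) simp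
  also have "alt t s k @ [t] = alt s t (Suc k)" by simp
  finally show ?case by auto
qed simp

lemma alt_double: "alt s t (2 * m) = concat (replicate m [s, t])"
proof (induction m)
  case (Suc m)
  have "alt s t (2 * Suc m) = s # t # alt s t (2 * m)"
    by (simp add: alt_Cons del: alt.simps(2))
  then show ?case using Suc by simp
qed simp

lemma alt_split: "\<exists>p. set p \<subseteq> {s, t} \<and> length p = j \<and> alt s t (j + k) = p @ alt s t k"
proof (induction j)
  case (Suc j)
  then obtain p where "set p \<subseteq> {s, t}" "length p = j" "alt s t (j + k) = p @ alt s t k" by blast
  then show ?case
    by (intro exI[of _ "(if even (j + k) then t else s) # p"]) (auto simp: alt_Cons simp del: alt.simps(2))
qed simp

section \<open>The geometric representation\<close>

locale coxeter = group W for W :: "('a, 'b) monoid_scheme" (structure) +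
  fixes S :: "'a set"
  assumes cox: "coxeter_system W S"
begin

abbreviation "\<alpha> \<equiv> simple_root :: 'a \<Rightarrow> 'a \<Rightarrow> real"
abbreviation "B \<equiv> cox_B W S"
abbreviation "\<sigma> \<equiv> sigma_s W S"

definition V :: "('a \<Rightarrow> real) set" where
  "V = {v. finite {x. v x \<noteq> 0} \<and> {x. v x \<noteq> 0} \<subseteq> S}"

text \<open>Linearity is asked on \<open>V\<close> only: \<open>B\<close> sums over supports, and a
  sum over an infinite set has the default value 0, so \<open>B w\<close> need not be linear
  elsewhere. One equation in \<open>lc\<close> covers both addition and scaling.\<close>

definition lin :: "(('a \<Rightarrow> real) \<Rightarrow> real) \<Rightarrow> bool" where
  "lin f \<longleftrightarrow> (\<forall>u\<in>V. \<forall>v\<in>V. \<forall>a b. f (lc a u b v) = a * f u + b * f v)"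

lemma S_carrier: "s \<in> S \<Longrightarrow> s \<in> carrier W"
  and S_sq: "s \<in> S \<Longrightarrow> s \<otimes> s = \<one>"
  and S_gen: "generate W S = carrier W"
  using cox by (auto simp: coxeter_system_def)

lemma S_inv: "s \<in> S \<Longrightarrow> inv s = s"
  by (simp add: S_carrier S_sq inv_equality)

lemma alpha_V [simp]: "s \<in> S \<Longrightarrow> \<alpha> s \<in> V"
  by (auto simp: V_def simple_root_def)

lemma lc_V [simp]: "u \<in> V \<Longrightarrow> v \<in> V \<Longrightarrow> lc a u b v \<in> V"
proof -
  assume "u \<in> V" "v \<in> V"
  moreover have "{x. lc a u b v x \<noteq> 0} \<subseteq> {x. u x \<noteq> 0} \<union> {x. v x \<noteq> 0}"
    by (auto simp: lc_def)
  ultimately show ?thesis unfolding V_def by (auto intro: finite_subset)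
qed

lemma linD: "lin f \<Longrightarrow> u \<in> V \<Longrightarrow> v \<in> V \<Longrightarrow> f (lc a u b v) = a * f u + b * f v"
  by (simp add: lin_def)

lemma lin_scale: "lin f \<Longrightarrow> v \<in> V \<Longrightarrow> f (\<lambda>x. a * v x) = a * f v"
  using linD[of f v v a 0] by (simp add: lc_def)

lemma lin_expand:
  assumes f: "lin f" and v: "v \<in> V"
  shows "f v = (\<Sum>s | v s \<noteq> 0. v s * f (\<alpha> s))"
proof -
  have "finite A \<Longrightarrow> A \<subseteq> S \<Longrightarrow>
      (\<lambda>x. if x \<in> A then v x else 0) \<in> V \<and>
      f (\<lambda>x. if x \<in> A then v x else 0) = (\<Sum>s\<in>A. v s * f (\<alpha> s))" for A
  proof (induction A rule: finite_induct)
    case empty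
    have "(\<lambda>x. 0) \<in> V" by (simp add: V_def)
    with lin_scale[OF f v, of 0] show ?case by simp
  next
    case (insert a A)
    have eq: "(\<lambda>x. if x \<in> insert a A then v x else 0) = lc (v a) (\<alpha> a) 1 (\<lambda>x. if x \<in> A then v x else 0)"
      using insert(2) by (auto simp: lc_def simple_root_def fun_eq_iff)
    show ?case unfolding eq using insert linD[OF f] by simp
  qed
  note * = this[of "{x. v x \<noteq> 0}"]
  have "(\<lambda>x. if x \<in> {x. v x \<noteq> 0} then v x else 0) = v" by auto
  then show ?thesis using * v by (simp add: V_def)
qed

text \<open>With one finite index set for both arguments, symmetry and bilinearity reduce to
  rearranging double sums.\<close>

lemma B_superset:
  assumes "finite A" "A \<subseteq> S" "{x. u x \<noteq> 0} \<subseteq> A" "{x. v x \<noteq> 0} \<subseteq> A"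
  shows "B u v = (\<Sum>s\<in>A. \<Sum>t\<in>A. u s * v t * cox_B0 W s t)"
proof -
  have "(\<Sum>s\<in>{s \<in> S. u s \<noteq> 0}. \<Sum>t\<in>{s \<in> S. v s \<noteq> 0}. u s * v t * cox_B0 W s t)
      = (\<Sum>s\<in>{s \<in> S. u s \<noteq> 0}. \<Sum>t\<in>A. u s * v t * cox_B0 W s t)"
    using assms by (intro sum.cong refl sum.mono_neutral_left) auto
  also have "\<dots> = (\<Sum>s\<in>A. \<Sum>t\<in>A. u s * v t * cox_B0 W s t)"
    using assms by (intro sum.mono_neutral_left) auto
  finally show ?thesis by (simp add: cox_B_def)
qed

lemma cox_m_sym: assumes "s \<in> S" "t \<in> S" shows "cox_m W s t = cox_m W t s"
proof -
  have "t \<otimes> s = inv (s \<otimes> t)" using assms by (simp add: inv_mult_group S_carrier S_inv)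
  then show ?thesis
    unfolding cox_m_def using assms ord_inv[of "s \<otimes> t"] by (simp add: S_carrier)
qed

lemma B0_sym: "s \<in> S \<Longrightarrow> t \<in> S \<Longrightarrow> cox_B0 W s t = cox_B0 W t s"
  by (simp add: cox_B0_def cox_m_sym)

lemma B_sym: assumes "u \<in> V" "v \<in> V" shows "B u v = B v u"
proof -
  let ?A = "{x. u x \<noteq> 0} \<union> {x. v x \<noteq> 0}"
  have A: "finite ?A" "?A \<subseteq> S" using assms by (auto simp: V_def)
  have "B u v = (\<Sum>s\<in>?A. \<Sum>t\<in>?A. u s * v t * cox_B0 W s t)" by (rule B_superset[OF A]) auto
  also have "\<dots> = (\<Sum>t\<in>?A. \<Sum>s\<in>?A. u s * v t * cox_B0 W s t)" by (rule sum.swap)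
  also have "\<dots> = (\<Sum>t\<in>?A. \<Sum>s\<in>?A. v t * u s * cox_B0 W t s)"
    by (intro sum.cong[OF HOL.refl]) (use A(2) in \<open>auto intro!: B0_sym\<close>)
  also have "\<dots> = B v u" by (rule B_superset[OF A, symmetric]) auto
  finally show ?thesis .
qed

lemma lin_B: assumes w: "w \<in> V" shows "lin (B w)"
  unfolding lin_def
proof (intro ballI allI)
  fix u v a b assume uv: "u \<in> V" "v \<in> V"
  let ?A = "{x. u x \<noteq> 0} \<union> {x. v x \<noteq> 0} \<union> {x. w x \<noteq> 0}"
  have A: "finite ?A" "?A \<subseteq> S" using uv w by (auto simp: V_def)
  have "B w (lc a u b v) = (\<Sum>s\<in>?A. \<Sum>t\<in>?A. w s * lc a u b v t * cox_B0 W s t)"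
    by (rule B_superset[OF A]) (auto simp: lc_def)
  also have "\<dots> = a * (\<Sum>s\<in>?A. \<Sum>t\<in>?A. w s * u t * cox_B0 W s t)
      + b * (\<Sum>s\<in>?A. \<Sum>t\<in>?A. w s * v t * cox_B0 W s t)"
    by (simp add: lc_def sum_distrib_left sum.distrib[symmetric] algebra_simps)
  also have "(\<Sum>s\<in>?A. \<Sum>t\<in>?A. w s * u t * cox_B0 W s t) = B w u"
    by (rule B_superset[OF A, symmetric]) auto
  also have "(\<Sum>s\<in>?A. \<Sum>t\<in>?A. w s * v t * cox_B0 W s t) = B w v"
    by (rule B_superset[OF A, symmetric]) auto
  finally show "B w (lc a u b v) = a * B w u + b * B w v" .
qed

lemma B_lc_right: "w \<in> V \<Longrightarrow> u \<in> V \<Longrightarrow> v \<in> V \<Longrightarrow> B w (lc a u b v) = a * B w u + b * B w v"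
  using lin_B by (rule linD)

lemma B_lc_left: "w \<in> V \<Longrightarrow> u \<in> V \<Longrightarrow> v \<in> V \<Longrightarrow> B (lc a u b v) w = a * B u w + b * B v w"
  by (simp add: B_sym[of _ w] B_lc_right)

lemma B_alpha: assumes "s \<in> S" "t \<in> S" shows "B (\<alpha> s) (\<alpha> t) = cox_B0 W s t"
proof -
  have 1: "{x \<in> S. \<alpha> s x \<noteq> 0} = {s}" "{x \<in> S. \<alpha> t x \<noteq> 0} = {t}"
    using assms by (auto simp: simple_root_def)
  show ?thesis unfolding cox_B_def 1 by (simp add: simple_root_def)
qed

text \<open>The order of \<open>s \<otimes> s\<close> is 1 and \<open>- cos pi = 1\<close>, so the
  general formula also normalizes the diagonal.\<close>

lemma B_alpha_self: "s \<in> S \<Longrightarrow> B (\<alpha> s) (\<alpha> s) = 1"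
  by (simp add: B_alpha cox_B0_def cox_m_def S_sq ord_id)

lemma sigma_lc: "\<sigma> s v = lc 1 v (- 2 * B (\<alpha> s) v) (\<alpha> s)"
  by (auto simp: sigma_s_def lc_def)

text \<open>The form with \<open>\<alpha> s\<close> is then an empty sum. This allows the invariance
  lemmas below to be stated for arbitrary words.\<close>

lemma sigma_outside: "s \<notin> S \<Longrightarrow> \<sigma> s v = v"
proof -
  assume "s \<notin> S"
  then have "{x \<in> S. \<alpha> s x \<noteq> 0} = {}" by (auto simp: simple_root_def)
  then have "B (\<alpha> s) v = 0" unfolding cox_B_def by (simp only: sum.empty)
  then show ?thesis by (simp add: sigma_s_def)
qed

lemma sigma_V [simp]: "v \<in> V \<Longrightarrow> \<sigma> s v \<in> V"
  by (cases "s \<in> S") (simp add: sigma_lc, simp add: sigma_outside)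

lemma sigma_linear:
  assumes "u \<in> V" "v \<in> V" shows "\<sigma> s (lc a u b v) = lc a (\<sigma> s u) b (\<sigma> s v)"
proof (cases "s \<in> S")
  case True
  then show ?thesis using assms unfolding sigma_lc
    by (simp add: B_lc_right) (auto simp: lc_def algebra_simps)
qed (simp add: sigma_outside)

lemma sigma_sigma: "v \<in> V \<Longrightarrow> \<sigma> s (\<sigma> s v) = v"
proof (cases "s \<in> S")
  case True
  assume v: "v \<in> V"
  have "B (\<alpha> s) (\<sigma> s v) = - B (\<alpha> s) v"
    unfolding sigma_lc using v True by (simp add: B_lc_right B_alpha_self)
  then show ?thesis by (auto simp: sigma_s_def)
qed (simp add: sigma_outside)

lemma B_sigma: assumes "u \<in> V" "v \<in> V" shows "B (\<sigma> s u) (\<sigma> s v) = B u v"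
proof (cases "s \<in> S")
  case True
  then show ?thesis using assms B_sym[of u "\<alpha> s"]
    by (simp add: sigma_lc B_lc_right B_lc_left B_alpha_self algebra_simps)
qed (simp add: sigma_outside)

lemma sigma_alpha_self: "s \<in> S \<Longrightarrow> \<sigma> s (\<alpha> s) = (\<lambda>x. - \<alpha> s x)"
  by (auto simp: sigma_s_def B_alpha_self)

lemma act_word_V [simp]: "v \<in> V \<Longrightarrow> act_word W S u v \<in> V"
  by (induction u) auto

lemma act_word_append: "act_word W S (u @ u') v = act_word W S u (act_word W S u' v)"
  by (induction u) auto

lemma act_word_linear:
  "u \<in> V \<Longrightarrow> v \<in> V \<Longrightarrow> act_word W S p (lc a u b v) = lc a (act_word W S p u) b (act_word W S p v)"
  by (induction p) (auto simp: sigma_linear)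

lemma lin_act_word: "lin (\<lambda>v. act_word W S p v z)"
  unfolding lin_def by (simp add: act_word_linear) (simp add: lc_def)

lemma B_act_word: "u \<in> V \<Longrightarrow> v \<in> V \<Longrightarrow> B (act_word W S p u) (act_word W S p v) = B u v"
  by (induction p) (auto simp: B_sigma)

section \<open>The braid relations in the geometric representation\<close>

lemma cox_m_ne_1: assumes "s \<in> S" "t \<in> S" "s \<noteq> t" shows "cox_m W s t \<noteq> 1"
proof
  assume "cox_m W s t = 1"
  then have "s \<otimes> t = \<one>"
    using assms pow_ord_eq_1[of "s \<otimes> t"] by (simp add: cox_m_def S_carrier)
  then have "inv t = s" using assms by (intro inv_equality) (auto simp: S_carrier)
  then show False using assms S_inv by simp
qed

text \<open>The parameter of the Chebyshev recurrence for the pair; 2 is the limit of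
  \<open>2 * cos (pi / m)\<close> for growing \<open>m\<close>.\<close>

definition cc :: "'a \<Rightarrow> 'a \<Rightarrow> real" where
  "cc s t = (if cox_m W s t = 0 then 2 else 2 * cos (pi / real (cox_m W s t)))"

lemma cc_B: "s \<in> S \<Longrightarrow> t \<in> S \<Longrightarrow> cc s t = - 2 * B (\<alpha> s) (\<alpha> t)"
  by (simp add: cc_def B_alpha cox_B0_def)

text \<open>Reflecting in one of the two letters replaces its coefficient \<open>p\<close> by
  \<open>c * q - p\<close>, where \<open>q\<close> is the other coefficient and
  \<open>c = cc s t\<close>. This is the recurrence of \<open>cheb\<close>.\<close>

lemma act_alt:
  assumes "s \<in> S" "t \<in> S"
  shows "act_word W S (alt s t k) (\<alpha> s) =
    lc (cheb (cc s t) (Suc k)) (\<alpha> (if even k then s else t)) (cheb (cc s t) k) (\<alpha> (if even k then t else s))"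
proof (induction k)
  case 0
  then show ?case by (auto simp: lc_def)
next
  case (Suc k)
  have ts: "B (\<alpha> t) (\<alpha> s) = B (\<alpha> s) (\<alpha> t)" using assms by (simp add: B_sym)
  show ?case
    unfolding alt_Cons act_word.simps Suc sigma_lc
    using assms by (auto simp: B_lc_right B_alpha_self cc_B ts)
      (auto simp: lc_def algebra_simps)
qed

text \<open>For distinct letters the form is nondegenerate on the plane of \<open>\<alpha> s\<close>
  and \<open>\<alpha> t\<close>, so \<open>V\<close> splits into this plane and its orthogonal
  complement. The complement is fixed by both reflections, and the plane by the periodicity of
  \<open>cheb\<close>.\<close>

lemma braid_acts_trivially:
  assumes s: "s \<in> S" and t: "t \<in> S" and m0: "cox_m W s t \<noteq> 0" and v: "v \<in> V"
  shows "act_word W S (concat (replicate (cox_m W s t) [s, t])) v = v"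
proof (cases "s = t")
  case True
  have "act_word W S (concat (replicate n [s, s])) v = v" for n
    by (induction n) (auto simp: sigma_sigma v)
  then show ?thesis using True by simp
next
  case False
  define m where "m = cox_m W s t"
  define p where "p = concat (replicate m [s, t])"
  have m: "m \<ge> 2" using cox_m_ne_1[OF s t False] m0 by (simp add: m_def)
  have mts: "cox_m W t s = m" using cox_m_sym[OF s t] by (simp add: m_def)
  have ps: "act_word W S p (\<alpha> s) = \<alpha> s"
    using act_alt[OF s t, of "2 * m"] cheb_period[OF m] m
    by (simp add: alt_double p_def cc_def m_def[symmetric]) (simp add: lc_def)
  have pt': "act_word W S (concat (replicate m [t, s])) (\<alpha> t) = \<alpha> t"
    using act_alt[OF t s, of "2 * m"] cheb_period[OF m] m
    by (simp add: alt_double cc_def mts) (simp add: lc_def)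
  \<comment> \<open>The periodicity of \<open>act_alt\<close> handles \<open>\<alpha> t\<close> only
    for the word that ends in \<open>t\<close>; the reversed word is its inverse, so it fixes
    \<open>\<alpha> t\<close> as well.\<close>
  have inv: "act_word W S (concat (replicate n [s, t])) (act_word W S (concat (replicate n [t, s])) x) = x"
    if "x \<in> V" for n x
    using that
  proof (induction n arbitrary: x)
    case (Suc n)
    have "concat (replicate (Suc n) [s, t]) = concat (replicate n [s, t]) @ [s, t]"
      by (metis append_Nil2 concat.simps concat_append replicate_Suc replicate_append_same)
    then show ?case using Suc by (simp add: act_word_append sigma_sigma)
  qed simp
  have pt: "act_word W S p (\<alpha> t) = \<alpha> t"
    using inv[of "\<alpha> t" m] pt' t by (simp add: p_def)
  have pfix: "act_word W S p u = u" if "u \<in> V" "B (\<alpha> s) u = 0" "B (\<alpha> t) u = 0" for u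
  proof -
    have "\<sigma> s u = u" "\<sigma> t u = u" using that by (auto simp: sigma_s_def)
    then have "act_word W S (concat (replicate n [s, t])) u = u" for n by (induction n) auto
    then show ?thesis by (simp add: p_def)
  qed
  define c where "c = cos (pi / real m)"
  have c: "c\<^sup>2 \<noteq> 1"
  proof -
    have "sin (pi / real m) > 0" using m by (intro sin_gt_zero) (auto simp: field_simps)
    then show ?thesis unfolding c_def cos_squared_eq by simp
  qed
  have Bst: "B (\<alpha> s) (\<alpha> t) = - c" "B (\<alpha> t) (\<alpha> s) = - c"
    using s t m mts by (auto simp: B_alpha cox_B0_def c_def m_def)
  define l where "l = B (\<alpha> s) v"
  define n where "n = B (\<alpha> t) v"
  \<comment> \<open>The numbers \<open>a\<close> and \<open>b\<close> solve the Gram system of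
    determinant \<open>1 - c\<^sup>2\<close>: \<open>w\<close> is the orthogonal projection of
    \<open>v\<close> to the plane.\<close>
  define a where "a = (l + c * n) / (1 - c\<^sup>2)"
  define b where "b = (n + c * l) / (1 - c\<^sup>2)"
  define w where "w = lc a (\<alpha> s) b (\<alpha> t)"
  have w: "w \<in> V" using s t by (simp add: w_def)
  have ab: "a - c * b = l" "b - c * a = n"
  proof -
    have d: "1 - c\<^sup>2 \<noteq> 0" using c by simp
    have "a - c * b = ((l + c * n) - c * (n + c * l)) / (1 - c\<^sup>2)"
      "b - c * a = ((n + c * l) - c * (l + c * n)) / (1 - c\<^sup>2)"
      by (simp_all add: a_def b_def diff_divide_distrib)
    moreover have "(l + c * n) - c * (n + c * l) = l * (1 - c\<^sup>2)"
      "(n + c * l) - c * (l + c * n) = n * (1 - c\<^sup>2)"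
      by (simp_all add: algebra_simps power2_eq_square)
    ultimately show "a - c * b = l" "b - c * a = n" using d by simp_all
  qed
  define u where "u = lc 1 v (-1) w"
  have u: "u \<in> V" using v w by (simp add: u_def)
  have "B (\<alpha> s) w = l" "B (\<alpha> t) w = n"
    using s t ab by (auto simp: w_def B_lc_right B_alpha_self Bst mult.commute)
  then have "B (\<alpha> s) u = 0" "B (\<alpha> t) u = 0"
    using s t v w by (auto simp: u_def B_lc_right l_def n_def)
  then have 1: "act_word W S p u = u" using pfix u by blast
  have 2: "act_word W S p w = w"
    unfolding w_def using s t ps pt by (simp add: act_word_linear)
  have "v = lc 1 u 1 w" by (auto simp: u_def lc_def)
  then have "act_word W S p v = v" using 1 2 act_word_linear[OF u w, of p 1 1] by simp
  then show ?thesis by (simp add: p_def m_def)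
qed

text \<open>Every defining relation holds for the operators, so the action of words descends to
  \<open>W\<close>.\<close>

lemma cox_eq_act:
  assumes "cox_eq W S p q" shows "\<And>v. v \<in> V \<Longrightarrow> act_word W S p v = act_word W S q v"
  using assms by (induction rule: cox_eq.induct)
    (auto simp: sigma_sigma braid_acts_trivially act_word_append)

section \<open>Length and positivity\<close>

lemma wprod_Nil [simp]: "wprod W [] = \<one>" and wprod_Cons [simp]: "wprod W (s # u) = s \<otimes> wprod W u"
  by (simp_all add: wprod_def)

lemma wprod_closed [simp]: "u \<in> lists S \<Longrightarrow> wprod W u \<in> carrier W"
  by (induction u) (auto simp: S_carrier)

lemma wprod_append: "u \<in> lists S \<Longrightarrow> v \<in> lists S \<Longrightarrow> wprod W (u @ v) = wprod W u \<otimes> wprod W v"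
  by (induction u) (auto simp: S_carrier m_assoc)

lemma ex_word:
  assumes "w \<in> carrier W" shows "\<exists>u\<in>lists S. wprod W u = w"
proof -
  have "w \<in> generate W S" using assms S_gen by simp
  then show ?thesis
  proof (induction rule: generate.induct)
    case one
    show ?case by (intro bexI[of _ "[]"]) auto
  next
    case (incl h)
    then show ?case by (intro bexI[of _ "[h]"]) (auto simp: S_carrier)
  next
    case (inv h)
    then show ?case by (intro bexI[of _ "[h]"]) (auto simp: S_carrier S_inv)
  next
    case (eng h1 h2)
    then obtain u v where "u \<in> lists S" "v \<in> lists S" "wprod W u = h1" "wprod W v = h2" by blast
    then show ?case by (intro bexI[of _ "u @ v"]) (simp_all add: wprod_append)
  qed
qed

definition len :: "'a \<Rightarrow> nat" where
  "len w = (LEAST n. \<exists>u\<in>lists S. length u = n \<and> wprod W u = w)"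

definition word :: "'a \<Rightarrow> 'a list" where
  "word w = (SOME u. u \<in> lists S \<and> length u = len w \<and> wprod W u = w)"

lemma word:
  assumes "w \<in> carrier W"
  shows "word w \<in> lists S" "length (word w) = len w" "wprod W (word w) = w"
proof -
  from ex_word[OF assms] have "\<exists>n. \<exists>u\<in>lists S. length u = n \<and> wprod W u = w" by blast
  then have "\<exists>u\<in>lists S. length u = len w \<and> wprod W u = w" unfolding len_def by (rule LeastI_ex)
  then have "\<exists>u. u \<in> lists S \<and> length u = len w \<and> wprod W u = w" by blast
  from someI_ex[OF this]
  show "word w \<in> lists S" "length (word w) = len w" "wprod W (word w) = w"
    unfolding word_def by auto
qed

lemma len_wprod_le: "u \<in> lists S \<Longrightarrow> len (wprod W u) \<le> length u"
  unfolding len_def by (rule Least_le) auto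

lemma len_mult_wprod:
  assumes "v \<in> carrier W" "u \<in> lists S" shows "len (v \<otimes> wprod W u) \<le> len v + length u"
  using len_wprod_le[of "word v @ u"] word[OF assms(1)] assms(2) by (simp add: wprod_append)

lemma len_mult_S: "v \<in> carrier W \<Longrightarrow> s \<in> S \<Longrightarrow> len (v \<otimes> s) \<le> Suc (len v)"
  using len_mult_wprod[of v "[s]"] by (simp add: S_carrier)

lemma mult_S_S: "v \<in> carrier W \<Longrightarrow> s \<in> S \<Longrightarrow> v \<otimes> s \<otimes> s = v"
  by (simp add: m_assoc S_carrier S_sq)

text \<open>A shortest word is chosen; by \<open>act_wprod\<close> below, any word over
  \<open>S\<close> for the element has the same effect on \<open>V\<close>.\<close>

definition act :: "'a \<Rightarrow> ('a \<Rightarrow> real) \<Rightarrow> 'a \<Rightarrow> real" where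
  "act w = act_word W S (word w)"

lemma act_wprod: assumes "u \<in> lists S" "v \<in> V" shows "act (wprod W u) v = act_word W S u v"
proof -
  have "wprod W u \<in> carrier W" using assms by simp
  note w = word[OF this]
  have "cox_eq W S (word (wprod W u)) u"
    using cox w assms(1) unfolding coxeter_system_def by blast
  then show ?thesis unfolding act_def using cox_eq_act assms(2) by blast
qed

lemma act_V [simp]: "v \<in> V \<Longrightarrow> act w v \<in> V"
  by (simp add: act_def)

lemma act_mult:
  assumes "w \<in> carrier W" "w' \<in> carrier W" "v \<in> V"
  shows "act (w \<otimes> w') v = act w (act w' v)"
proof -
  have "act (wprod W (word w @ word w')) v = act w (act w' v)"
    using assms word(1) by (subst act_wprod) (auto simp: act_word_append act_def)
  then show ?thesis using assms word by (simp add: wprod_append)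
qed

lemma act_one [simp]: "v \<in> V \<Longrightarrow> act \<one> v = v"
  using act_wprod[of "[]" v] by simp

lemma act_S: "s \<in> S \<Longrightarrow> v \<in> V \<Longrightarrow> act s v = \<sigma> s v"
  using act_wprod[of "[s]" v] by (simp add: S_carrier)

lemma act_inv_act: "w \<in> carrier W \<Longrightarrow> v \<in> V \<Longrightarrow> act (inv w) (act w v) = v"
  and act_act_inv: "w \<in> carrier W \<Longrightarrow> v \<in> V \<Longrightarrow> act w (act (inv w) v) = v"
  by (simp_all add: act_mult[symmetric])

lemma act_lc: "u \<in> V \<Longrightarrow> v \<in> V \<Longrightarrow> act w (lc a u b v) = lc a (act w u) b (act w v)"
  unfolding act_def by (rule act_word_linear)

lemma lin_act_coord: "lin (\<lambda>v. act w v z)"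
  unfolding act_def by (rule lin_act_word)

lemma act_uminus: "v \<in> V \<Longrightarrow> act w (\<lambda>x. - v x) = (\<lambda>x. - act w v x)"
  using act_lc[of v v w "-1" 0] by (simp add: lc_def)

lemma B_act: "u \<in> V \<Longrightarrow> v \<in> V \<Longrightarrow> B (act w u) (act w v) = B u v"
  unfolding act_def by (rule B_act_word)

lemma wprod_alt_closed [simp]: "s \<in> S \<Longrightarrow> t \<in> S \<Longrightarrow> wprod W (alt s t k) \<in> carrier W"
  by (simp add: alt_in_lists)

lemma wprod_alt_Suc: "s \<in> S \<Longrightarrow> t \<in> S \<Longrightarrow> wprod W (alt s t (Suc k)) = wprod W (alt t s k) \<otimes> t"
  by (simp add: wprod_append alt_in_lists S_carrier)

text \<open>A general \<open>k\<close> makes the induction possible. When \<open>k\<close> is the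
  order of \<open>s \<otimes> t\<close> the power is trivial, and the braid relation
  results.\<close>

lemma wprod_alt_pow:
  "s \<in> S \<Longrightarrow> t \<in> S \<Longrightarrow> wprod W (alt t s k) \<otimes> (s \<otimes> t) [^] k = wprod W (alt s t k)"
proof (induction k arbitrary: s t)
  case (Suc k)
  note st = Suc.prems S_carrier[OF Suc.prems(1)] S_carrier[OF Suc.prems(2)]
  have comm: "t \<otimes> (s \<otimes> t) [^] k = (t \<otimes> s) [^] k \<otimes> t" for k :: nat
  proof (induction k)
    case (Suc k)
    have "t \<otimes> (s \<otimes> t) [^] Suc k = (t \<otimes> (s \<otimes> t) [^] k) \<otimes> (s \<otimes> t)"
      using st by (simp add: m_assoc)
    also have "\<dots> = (t \<otimes> s) [^] Suc k \<otimes> t" using st by (subst Suc) (simp add: m_assoc)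
    finally show ?case .
  qed (use st in simp)
  have "s \<otimes> (s \<otimes> t) [^] Suc k = s \<otimes> ((s \<otimes> t) \<otimes> (s \<otimes> t) [^] k)"
    using st nat_pow_Suc2[of "s \<otimes> t" k] by simp
  also have "\<dots> = t \<otimes> (s \<otimes> t) [^] k" using st by (simp add: m_assoc[symmetric] S_sq)
  finally have 1: "s \<otimes> (s \<otimes> t) [^] Suc k = (t \<otimes> s) [^] k \<otimes> t" by (simp add: comm)
  have "wprod W (alt t s (Suc k)) \<otimes> (s \<otimes> t) [^] Suc k
      = wprod W (alt s t k) \<otimes> (s \<otimes> (s \<otimes> t) [^] Suc k)"
    using st by (subst wprod_alt_Suc) (simp_all add: m_assoc del: nat_pow_Suc)
  also have "\<dots> = wprod W (alt s t k) \<otimes> (t \<otimes> s) [^] k \<otimes> t"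
    unfolding 1 using st by (simp add: m_assoc)
  also have "\<dots> = wprod W (alt t s k) \<otimes> t" using Suc.IH[of t s] st by simp
  also have "\<dots> = wprod W (alt s t (Suc k))" using st by (subst wprod_alt_Suc) simp_all
  finally show ?case .
qed (simp add: S_carrier)

lemma wprod_alt_braid:
  assumes "s \<in> S" "t \<in> S"
  shows "wprod W (alt t s (cox_m W s t)) = wprod W (alt s t (cox_m W s t))"
  using wprod_alt_pow[OF assms, of "cox_m W s t"] assms pow_ord_eq_1[of "s \<otimes> t"]
  by (simp add: cox_m_def S_carrier)

abbreviation nonneg :: "('a \<Rightarrow> real) \<Rightarrow> bool" where "nonneg v \<equiv> \<forall>x. 0 \<le> v x"

text \<open>The alternating suffix of \<open>w\<close> in the two letters \<open>s\<close>, \<open>t\<close> is chosen as long as possible;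
  the complementary prefix then lengthens under both letters, and the suffix is shorter than
  the order of \<open>s t\<close>, so it maps \<open>\<alpha> s\<close> into the cone of \<open>\<alpha> s\<close> and \<open>\<alpha> t\<close>.\<close>

lemma act_alpha_nonneg:
  "w \<in> carrier W \<Longrightarrow> s \<in> S \<Longrightarrow> len w \<le> len (w \<otimes> s) \<Longrightarrow> nonneg (act w (\<alpha> s))"
proof (induction "len w" arbitrary: w s rule: less_induct)
  case (less w s)
  note w = less.prems(1) and s = less.prems(2) and ws = less.prems(3)
  show ?case
  proof (cases "word w" rule: rev_cases)
    case Nil
    then have "w = \<one>" using word(3)[OF w] by simp
    then show ?thesis using s by (simp add: act_one) (simp add: simple_root_def)
  next
    case (snoc u t)
    then have ut: "u \<in> lists S" "t \<in> S" using word(1)[OF w] by auto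
    have wu: "w = wprod W u \<otimes> t" "len w = Suc (length u)"
      using word(2,3)[OF w] snoc ut by (auto simp: wprod_append S_carrier)
    have ts: "t \<noteq> s"
    proof
      assume "t = s"
      then have "w \<otimes> s = wprod W u" using wu ut by (simp add: mult_S_S)
      then show False using len_wprod_le[OF ut(1)] ws wu by simp
    qed
    define Q where "Q = (\<lambda>k. \<exists>v\<in>carrier W. w = v \<otimes> wprod W (alt s t k) \<and> len v + k = len w)"
    have "len (wprod W u) = length u"
      using len_wprod_le[OF ut(1)] len_mult_S[of "wprod W u" t] ut wu by simp
    then have Q1: "Q 1"
      unfolding Q_def using wu ut by (intro bexI[of _ "wprod W u"]) (auto simp: S_carrier)
    have Qle: "Q k \<Longrightarrow> k \<le> len w" for k by (auto simp: Q_def)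
    define k where "k = (GREATEST k. Q k)"
    have Qk: "Q k" unfolding k_def using Q1 Qle by (rule GreatestI_nat)
    have "1 \<le> k" unfolding k_def using Q1 Qle by (rule Greatest_le_nat)
    then obtain j where j: "k = Suc j" by (cases k) auto
    have nQ: "\<not> Q (Suc k)" using Greatest_le_nat[of Q "Suc k" "len w"] Qle unfolding k_def by force
    from Qk obtain v where v: "v \<in> carrier W" "w = v \<otimes> wprod W (alt s t k)" "len v + k = len w"
      by (auto simp: Q_def)
    define x where "x = (if even j then t else s)"
    define y where "y = (if even k then t else s)"
    have xy: "x \<in> S" "y \<in> S" using s ut by (auto simp: x_def y_def)
    have altk: "alt s t k = x # alt s t j" and altSk: "alt s t (Suc k) = y # alt s t k"
      by (simp_all add: alt_Cons x_def y_def j del: alt.simps(2))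
    \<comment> \<open>The letter \<open>y\<close> would extend the suffix to the left: were
      \<open>v \<otimes> y\<close> shorter than \<open>v\<close>, the suffix would not be maximal.
      The letter \<open>x\<close> opens the suffix: were \<open>v \<otimes> x\<close> shorter,
      \<open>w\<close> would have too short an expression.\<close>
    have "len v \<le> len (v \<otimes> y)"
    proof (rule ccontr)
      assume "\<not> ?thesis"
      then have "len v = Suc (len (v \<otimes> y))"
        using len_mult_S[of "v \<otimes> y" y] mult_S_S[of v y] v xy by (simp add: S_carrier)
      moreover have "w = (v \<otimes> y) \<otimes> wprod W (alt s t (Suc k))"
        unfolding altSk using v xy s ut by (simp add: m_assoc[symmetric] S_carrier mult_S_S)
      ultimately have "Q (Suc k)" unfolding Q_def using v xy
        by (intro bexI[of _ "v \<otimes> y"]) (auto simp: S_carrier)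
      with nQ show False ..
    qed
    moreover have "len v \<le> len (v \<otimes> x)"
    proof (rule ccontr)
      assume a: "\<not> ?thesis"
      have "w = (v \<otimes> x) \<otimes> wprod W (alt s t j)"
        using v xy s ut by (simp add: altk m_assoc S_carrier)
      then have "len w \<le> len (v \<otimes> x) + j"
        using len_mult_wprod[of "v \<otimes> x" "alt s t j"] v xy s ut by (simp add: S_carrier alt_in_lists)
      then show False using a v j by simp
    qed
    moreover have "len v < len w" using v j by simp
    ultimately have pos: "nonneg (act v (\<alpha> x))" "nonneg (act v (\<alpha> y))"
      using less.hyps v(1) xy by blast+
    have "{x, y} = {s, t}" by (auto simp: x_def y_def j)
    with pos have pos: "nonneg (act v (\<alpha> s))" "nonneg (act v (\<alpha> t))"
      by (auto simp: doubleton_eq_iff)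
    define m where "m = cox_m W s t"
    have m1: "m \<noteq> 1" using cox_m_ne_1 s ut ts by (auto simp: m_def)
    \<comment> \<open>If \<open>k\<close> reached \<open>m\<close>, the braid relation could rewrite
      the end of the suffix to finish in \<open>s\<close>, and \<open>w \<otimes> s\<close> would be
      shorter than \<open>w\<close>.\<close>
    have km: "k < m" if m0: "m \<noteq> 0"
    proof (rule ccontr)
      assume "\<not> k < m"
      then have "k = (k - m) + m" by simp
      then obtain p where p: "set p \<subseteq> {s, t}" "length p = k - m" "alt s t k = p @ alt s t m"
        using alt_split[of s t "k - m" m] by metis
      have pS: "p \<in> lists S" using p(1) s ut by auto
      obtain n where n: "m = Suc n" using m0 by (cases m) auto
      have "w = v \<otimes> wprod W p \<otimes> wprod W (alt t s m)"
        using v p pS s ut wprod_alt_braid[of s t]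
        by (simp add: wprod_append alt_in_lists m_assoc m_def)
      also have "\<dots> = v \<otimes> wprod W p \<otimes> wprod W (alt s t n) \<otimes> s"
        unfolding n using v pS s ut by (subst wprod_alt_Suc) (simp_all add: m_assoc S_carrier)
      finally have "w \<otimes> s = v \<otimes> wprod W (p @ alt s t n)"
        using v pS s ut by (simp add: mult_S_S wprod_append alt_in_lists m_assoc)
      then have "len (w \<otimes> s) \<le> len v + ((k - m) + n)"
        using len_mult_wprod[of v "p @ alt s t n"] v pS s ut p by (simp add: alt_in_lists)
      then show False using ws v n \<open>\<not> k < m\<close> by simp
    qed
    have c: "cheb (cc s t) (Suc k) \<ge> 0" "cheb (cc s t) k \<ge> 0"
      using cheb_nonneg[of m "Suc k"] cheb_nonneg[of m k] km m1 by (auto simp: cc_def m_def)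
    have "act w (\<alpha> s) = act v (act_word W S (alt s t k) (\<alpha> s))"
      using v s ut by (simp add: act_mult act_wprod alt_in_lists)
    also have "\<dots> = lc (cheb (cc s t) (Suc k)) (act v (\<alpha> (if even k then s else t)))
        (cheb (cc s t) k) (act v (\<alpha> (if even k then t else s)))"
      using s ut by (subst act_alt) (auto simp: act_lc)
    finally show ?thesis using c pos by (auto simp: lc_def)
  qed
qed

lemma act_mult_alpha: "w \<in> carrier W \<Longrightarrow> s \<in> S \<Longrightarrow> act (w \<otimes> s) (\<alpha> s) = (\<lambda>x. - act w (\<alpha> s) x)"
  by (simp add: act_mult S_carrier act_S sigma_alpha_self act_uminus)

lemma act_alpha_nonpos:
  assumes "w \<in> carrier W" "s \<in> S" "len (w \<otimes> s) < len w" shows "\<forall>x. act w (\<alpha> s) x \<le> 0"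
  using act_alpha_nonneg[of "w \<otimes> s" s] assms by (simp add: mult_S_S S_carrier act_mult_alpha)

lemma act_alpha_sign:
  assumes "w \<in> carrier W" "s \<in> S"
  shows "nonneg (act w (\<alpha> s)) \<or> nonneg (\<lambda>x. - act w (\<alpha> s) x)"
  using act_alpha_nonneg[OF assms] act_alpha_nonpos[OF assms] by fastforce

lemma ex_descent:
  assumes w: "w \<in> carrier W" "w \<noteq> \<one>" shows "\<exists>s\<in>S. len (w \<otimes> s) < len w"
proof (cases "word w" rule: rev_cases)
  case Nil
  then show ?thesis using word(3)[OF w(1)] w(2) by simp
next
  case (snoc u t)
  then have ut: "u \<in> lists S" "t \<in> S" using word(1)[OF w(1)] by auto
  have wu: "w = wprod W u \<otimes> t" "len w = Suc (length u)"
    using word(2,3)[OF w(1)] snoc ut by (auto simp: wprod_append S_carrier)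
  then have "w \<otimes> t = wprod W u" using ut by (simp add: mult_S_S)
  then show ?thesis using len_wprod_le[OF ut(1)] wu(2) ut(2) by (intro bexI[of _ t]) simp_all
qed

lemma B_act_alpha: "s \<in> S \<Longrightarrow> B (act w (\<alpha> s)) (act w (\<alpha> s)) = 1"
  by (simp add: B_act B_alpha_self)

text \<open>A descent \<open>s\<close> would make \<open>act w (\<alpha> s)\<close> both nonnegative
  and nonpositive, hence zero, although its norm is 1. Faithfulness of the representation follows in
  \<open>act_inject\<close>.\<close>

lemma act_eq_one:
  assumes w: "w \<in> carrier W" and "\<And>s. s \<in> S \<Longrightarrow> nonneg (act w (\<alpha> s))"
  shows "w = \<one>"
proof (rule ccontr)
  assume "w \<noteq> \<one>"
  then obtain s where s: "s \<in> S" "len (w \<otimes> s) < len w" using ex_descent w by blast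
  then have "act w (\<alpha> s) = (\<lambda>_. 0)"
    using act_alpha_nonpos[OF w s] assms(2)[OF s(1)] by (auto intro!: HOL.ext order.antisym)
  then show False using B_act_alpha[OF s(1), of w] by (simp add: cox_B_def)
qed

section \<open>Roots\<close>

abbreviation "Pos \<equiv> pos_roots W S"

lemma roots_iff: "\<gamma> \<in> roots W S \<longleftrightarrow> (\<exists>w\<in>carrier W. \<exists>s\<in>S. \<gamma> = act w (\<alpha> s))"
proof
  assume "\<gamma> \<in> roots W S"
  then obtain u s where "u \<in> lists S" "s \<in> S" "\<gamma> = act_word W S u (\<alpha> s)"
    by (auto simp: roots_def)
  then show "\<exists>w\<in>carrier W. \<exists>s\<in>S. \<gamma> = act w (\<alpha> s)"
    by (intro bexI[of _ "wprod W u"] bexI[of _ s]) (simp_all add: act_wprod)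
next
  assume "\<exists>w\<in>carrier W. \<exists>s\<in>S. \<gamma> = act w (\<alpha> s)"
  then show "\<gamma> \<in> roots W S" unfolding roots_def act_def using word(1) by blast
qed

lemma roots_V [simp]: "\<gamma> \<in> roots W S \<Longrightarrow> \<gamma> \<in> V"
  and roots_B: "\<gamma> \<in> roots W S \<Longrightarrow> B \<gamma> \<gamma> = 1"
  and roots_sign: "\<gamma> \<in> roots W S \<Longrightarrow> nonneg \<gamma> \<or> nonneg (\<lambda>x. - \<gamma> x)"
  by (auto simp: roots_iff B_act_alpha dest: act_alpha_sign)

lemma roots_nonzero: assumes "\<gamma> \<in> roots W S" shows "\<exists>x. \<gamma> x \<noteq> 0"
proof (rule ccontr)
  assume "\<not> ?thesis"
  then show False using roots_B[OF assms] by (simp add: cox_B_def)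
qed

lemma Pos_iff: "\<gamma> \<in> Pos \<longleftrightarrow> \<gamma> \<in> roots W S \<and> nonneg \<gamma>"
  by (auto simp: pos_roots_def)

lemma roots_act: "w \<in> carrier W \<Longrightarrow> \<gamma> \<in> roots W S \<Longrightarrow> act w \<gamma> \<in> roots W S"
  unfolding roots_iff by (metis act_mult alpha_V m_closed)

lemma roots_uminus: assumes "\<gamma> \<in> roots W S" shows "(\<lambda>x. - \<gamma> x) \<in> roots W S"
proof -
  obtain w s where ws: "w \<in> carrier W" "s \<in> S" "\<gamma> = act w (\<alpha> s)"
    using assms by (auto simp: roots_iff)
  then have "(\<lambda>x. - \<gamma> x) = act (w \<otimes> s) (\<alpha> s)" by (simp add: act_mult_alpha)
  then show ?thesis unfolding roots_iff using ws S_carrier by blast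
qed

lemma alpha_roots: "s \<in> S \<Longrightarrow> \<alpha> s \<in> roots W S"
  unfolding roots_iff by (metis act_one alpha_V one_closed)

lemma alpha_Pos: "s \<in> S \<Longrightarrow> \<alpha> s \<in> Pos"
  by (simp add: Pos_iff alpha_roots) (simp add: simple_root_def)

lemma act_conj:
  assumes w: "w \<in> carrier W" and s: "s \<in> S" and v: "v \<in> V"
  shows "act (w \<otimes> s \<otimes> inv w) v = lc 1 v (- 2 * B (act w (\<alpha> s)) v) (act w (\<alpha> s))"
proof -
  have "B (\<alpha> s) (act (inv w) v) = B (act w (\<alpha> s)) v"
    using B_act[of "\<alpha> s" "act (inv w) v" w] assms by (simp add: act_act_inv)
  then show ?thesis
    using assms by (simp add: act_mult S_carrier act_S sigma_lc act_lc act_act_inv)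
qed

lemma act_inject:
  assumes "w \<in> carrier W" "w' \<in> carrier W" "\<And>v. v \<in> V \<Longrightarrow> act w v = act w' v"
  shows "w = w'"
proof -
  have "inv w' \<otimes> w = \<one>"
  proof (rule act_eq_one)
    fix s assume "s \<in> S"
    then have "act (inv w' \<otimes> w) (\<alpha> s) = \<alpha> s"
      using assms by (simp add: act_mult act_inv_act)
    then show "nonneg (act (inv w' \<otimes> w) (\<alpha> s))" by (simp add: simple_root_def)
  qed (use assms in simp)
  then show ?thesis using assms by (metis inv_closed inv_equality inv_inv)
qed

text \<open>The choice in \<open>root_refl\<close> is harmless: by \<open>act_conj\<close> the
  action of a reflection depends only on its root, and the action is faithful.\<close>

lemma root_refl_act:
  assumes w: "w \<in> carrier W" and s: "s \<in> S"
  shows "root_refl W S (act w (\<alpha> s)) = w \<otimes> s \<otimes> inv w"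
proof -
  let ?P = "\<lambda>r. \<exists>u t. u \<in> lists S \<and> t \<in> S \<and> act w (\<alpha> s) = act_word W S u (\<alpha> t)
       \<and> r = wprod W u \<otimes> t \<otimes> inv (wprod W u)"
  have "?P (w \<otimes> s \<otimes> inv w)"
    using word[OF w] s by (intro exI[of _ "word w"] exI[of _ s]) (simp add: act_def)
  then have "?P (SOME r. ?P r)" by (rule someI)
  then obtain u t where u: "u \<in> lists S" "t \<in> S" "act w (\<alpha> s) = act_word W S u (\<alpha> t)"
      "root_refl W S (act w (\<alpha> s)) = wprod W u \<otimes> t \<otimes> inv (wprod W u)"
    unfolding root_refl_def by blast
  then have eq: "act (wprod W u) (\<alpha> t) = act w (\<alpha> s)" by (simp add: act_wprod)
  show ?thesis unfolding u(4)
  proof (rule act_inject)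
    fix v assume "v \<in> V"
    then show "act (wprod W u \<otimes> t \<otimes> inv (wprod W u)) v = act (w \<otimes> s \<otimes> inv w) v"
      using act_conj[of w s v] act_conj[of "wprod W u" t v] eq u w s by simp
  qed (use u w s in \<open>simp_all add: S_carrier\<close>)
qed

lemma root_refl_roots:
  assumes "\<gamma> \<in> roots W S"
  shows "root_refl W S \<gamma> \<in> reflections W S" "root_refl W S \<gamma> \<in> carrier W"
    "v \<in> V \<Longrightarrow> act (root_refl W S \<gamma>) v = lc 1 v (- 2 * B \<gamma> v) \<gamma>"
proof -
  obtain w s where ws: "w \<in> carrier W" "s \<in> S" "\<gamma> = act w (\<alpha> s)" using assms by (auto simp: roots_iff)
  then have r: "root_refl W S \<gamma> = w \<otimes> s \<otimes> inv w" by (simp add: root_refl_act)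
  show "root_refl W S \<gamma> \<in> reflections W S" unfolding r reflections_def using ws by blast
  show "root_refl W S \<gamma> \<in> carrier W" unfolding r using ws by (simp add: S_carrier)
  show "v \<in> V \<Longrightarrow> act (root_refl W S \<gamma>) v = lc 1 v (- 2 * B \<gamma> v) \<gamma>"
    unfolding r using act_conj ws by simp
qed

text \<open>Only the coordinate at \<open>s\<close> changes. A positive root turned negative is thus
  a multiple of \<open>\<alpha> s\<close>, and norm 1 with positivity leaves
  \<open>\<alpha> s\<close> itself.\<close>

lemma sigma_Pos:
  assumes b: "\<beta> \<in> Pos" and s: "s \<in> S" and ne: "\<beta> \<noteq> \<alpha> s"
  shows "\<sigma> s \<beta> \<in> Pos"
proof (rule ccontr)
  assume a: "\<not> ?thesis"
  have bV: "\<beta> \<in> V" "\<beta> \<in> roots W S" "nonneg \<beta>" using b by (auto simp: Pos_iff)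
  have "\<sigma> s \<beta> \<in> roots W S" using roots_act[of s \<beta>] s bV by (simp add: act_S S_carrier)
  with a have neg: "\<forall>x. \<sigma> s \<beta> x \<le> 0" using roots_sign[of "\<sigma> s \<beta>"] by (auto simp: Pos_iff)
  have "\<beta> x = 0" if "x \<noteq> s" for x
    using neg[rule_format, of x] bV(3)[rule_format, of x] that by (simp add: sigma_s_def simple_root_def)
  then have eq: "\<beta> = lc (\<beta> s) (\<alpha> s) 0 (\<alpha> s)" by (auto simp: lc_def simple_root_def)
  have "B (lc c (\<alpha> s) 0 (\<alpha> s)) (lc c (\<alpha> s) 0 (\<alpha> s)) = c * c" for c
    using s by (simp add: B_lc_left B_lc_right B_alpha_self)
  then have "\<beta> s * \<beta> s = 1" using roots_B[OF bV(2)] eq by metis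
  then have "\<beta> s = 1" using bV(3) by (metis abs_of_nonneg abs_square_eq_1 power2_eq_square)
  then have "\<beta> = \<alpha> s" using eq by (simp add: lc_def)
  with ne show False ..
qed

lemma act_inj_on: "w \<in> carrier W \<Longrightarrow> inj_on (act w) V"
  by (rule inj_onI) (metis act_inv_act)

text \<open>Prefixing a letter \<open>s\<close> to a word adds at most one inversion, namely the
  root that the word sends to \<open>\<alpha> s\<close>.\<close>

lemma finite_inversions:
  assumes w: "w \<in> carrier W" shows "finite {\<beta> \<in> Pos. \<not> nonneg (act w \<beta>)}"
proof -
  have "u \<in> lists S \<Longrightarrow> finite {\<beta> \<in> Pos. \<not> nonneg (act_word W S u \<beta>)}" for u
  proof (induction u)
    case Nil
    have "{\<beta> \<in> Pos. \<not> nonneg (act_word W S [] \<beta>)} = {}" by (auto simp: Pos_iff)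
    then show ?case by (simp only: finite.emptyI)
  next
    case (Cons s u)
    have s: "s \<in> S" and u: "u \<in> lists S" using Cons.prems by auto
    have "{\<beta> \<in> Pos. \<not> nonneg (act_word W S (s # u) \<beta>)} \<subseteq>
        {\<beta> \<in> Pos. \<not> nonneg (act_word W S u \<beta>)} \<union> {act (inv (wprod W u)) (\<alpha> s)}"
    proof
      fix \<beta> assume b: "\<beta> \<in> {\<beta> \<in> Pos. \<not> nonneg (act_word W S (s # u) \<beta>)}"
      then have bV: "\<beta> \<in> V" "\<beta> \<in> roots W S" by (auto simp: Pos_iff)
      have r: "act_word W S u \<beta> \<in> roots W S"
        using roots_act[of "wprod W u" \<beta>] bV u by (simp add: act_wprod)
      show "\<beta> \<in> {\<beta> \<in> Pos. \<not> nonneg (act_word W S u \<beta>)} \<union> {act (inv (wprod W u)) (\<alpha> s)}"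
      proof (cases "nonneg (act_word W S u \<beta>)")
        case True
        then have "act (wprod W u) \<beta> = \<alpha> s"
          using sigma_Pos[of "act_word W S u \<beta>" s] r s b bV u by (auto simp: Pos_iff act_wprod)
        then show ?thesis using act_inv_act[of "wprod W u" \<beta>] bV u by auto
      qed (use b in auto)
    qed
    then show ?case using Cons.IH[OF u] by (auto intro: finite_subset)
  qed
  from this[of "word w"] show ?thesis using word(1)[OF w] by (simp add: act_def)
qed

section \<open>Stabilizers of points in the Tits cone\<close>

text \<open>The interior points of the Tits cone, as linear functionals on \<open>V\<close>.\<close>

definition U :: "(('a \<Rightarrow> real) \<Rightarrow> real) set" where
  "U = {x. lin x \<and> finite {\<beta> \<in> Pos. x \<beta> \<le> 0}}"

definition Stab :: "(('a \<Rightarrow> real) \<Rightarrow> real) \<Rightarrow> 'a set" where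
  "Stab x = {h \<in> carrier W. \<forall>v\<in>V. x (act h v) = x v}"

lemma Stab_subgroup: "subgroup (Stab x) W"
proof
  fix h assume h: "h \<in> Stab x"
  have "x (act (inv h) v) = x v" if v: "v \<in> V" for v
  proof -
    have "x (act h (act (inv h) v)) = x (act (inv h) v)" using h v by (simp add: Stab_def)
    then show ?thesis using h v by (simp add: act_act_inv Stab_def)
  qed
  then show "inv h \<in> Stab x" using h by (simp add: Stab_def)
qed (auto simp: Stab_def act_mult)

lemma lin_act: "lin x \<Longrightarrow> lin (\<lambda>v. x (act w v))"
  by (simp add: lin_def act_lc)

text \<open>A positive root counted for the new functional is either an inversion of
  \<open>w\<close> or is sent injectively by \<open>w\<close> into the finite set for
  \<open>x\<close>.\<close>

lemma U_act: assumes x: "x \<in> U" and w: "w \<in> carrier W" shows "(\<lambda>v. x (act w v)) \<in> U"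
proof -
  have fin: "finite (act w -` {\<beta> \<in> Pos. x \<beta> \<le> 0} \<inter> V)"
    using x by (intro finite_vimage_IntI act_inj_on[OF w]) (simp add: U_def)
  have "{\<beta> \<in> Pos. x (act w \<beta>) \<le> 0} \<subseteq>
      {\<beta> \<in> Pos. \<not> nonneg (act w \<beta>)} \<union> (act w -` {\<beta> \<in> Pos. x \<beta> \<le> 0} \<inter> V)"
    using roots_act[OF w] by (auto simp: Pos_iff)
  then have "finite {\<beta> \<in> Pos. x (act w \<beta>) \<le> 0}"
    using fin finite_inversions[OF w] by (auto intro: finite_subset)
  then show ?thesis using x lin_act by (simp add: U_def)
qed

lemma lin_uminus: "lin x \<Longrightarrow> v \<in> V \<Longrightarrow> x (\<lambda>z. - v z) = - x v"
  using lin_scale[of x v "-1"] by simp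

lemma refl_in_Stab:
  assumes "lin x" "\<gamma> \<in> roots W S" shows "root_refl W S \<gamma> \<in> Stab x \<longleftrightarrow> x \<gamma> = 0"
proof
  assume "root_refl W S \<gamma> \<in> Stab x"
  then have "x (act (root_refl W S \<gamma>) \<gamma>) = x \<gamma>" using assms by (simp add: Stab_def)
  then show "x \<gamma> = 0" using assms by (simp add: root_refl_roots linD roots_B)
next
  assume "x \<gamma> = 0"
  then show "root_refl W S \<gamma> \<in> Stab x"
    using assms by (auto simp: Stab_def root_refl_roots linD)
qed

text \<open>If \<open>x (\<alpha> s) < 0\<close>, then composing \<open>x\<close> with
  \<open>s\<close> lowers the number of negative positive roots: \<open>s\<close> keeps positive all
  positive roots except \<open>\<alpha> s\<close>, and \<open>\<alpha> s\<close> drops out of the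
  count.\<close>

lemma to_dominant:
  assumes "lin x" "finite {\<beta> \<in> Pos. x \<beta> < 0}"
  shows "\<exists>w\<in>carrier W. \<forall>s\<in>S. 0 \<le> x (act w (\<alpha> s))"
  using assms
proof (induction "card {\<beta> \<in> Pos. x \<beta> < 0}" arbitrary: x rule: less_induct)
  case (less x)
  show ?case
  proof (cases "\<forall>s\<in>S. 0 \<le> x (\<alpha> s)")
    case True
    then show ?thesis by (intro bexI[of _ \<one>]) auto
  next
    case False
    then obtain s where s: "s \<in> S" "x (\<alpha> s) < 0" by auto
    let ?N = "{\<beta> \<in> Pos. x \<beta> < 0}" and ?N' = "{\<beta> \<in> Pos. x (act s \<beta>) < 0}"
    have sub: "act s ` ?N' \<subseteq> ?N - {\<alpha> s}"
    proof
      fix b assume "b \<in> act s ` ?N'"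
      then obtain \<beta> where \<beta>: "\<beta> \<in> Pos" "x (act s \<beta>) < 0" "b = act s \<beta>" by auto
      have V: "\<beta> \<in> V" using \<beta> by (simp add: Pos_iff)
      have "\<beta> \<noteq> \<alpha> s"
        using \<beta> s less.prems(1) by (auto simp: act_S sigma_alpha_self lin_uminus)
      then have "act s \<beta> \<in> Pos" using sigma_Pos \<beta>(1) s V by (simp add: act_S)
      moreover have "act s \<beta> \<noteq> \<alpha> s"
      proof
        assume "act s \<beta> = \<alpha> s"
        then have "\<beta> = (\<lambda>z. - \<alpha> s z)"
          using s V sigma_sigma[OF V, of s] by (simp add: act_S sigma_alpha_self)
        moreover have "\<beta> s \<ge> 0" using \<beta>(1) by (simp add: Pos_iff)
        ultimately show False by (simp add: simple_root_def)
      qed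
      ultimately show "b \<in> ?N - {\<alpha> s}" using \<beta> by simp
    qed
    have inj: "inj_on (act s) ?N'"
      by (rule inj_on_subset[OF act_inj_on]) (auto simp: Pos_iff S_carrier s)
    have finN: "finite ?N'"
      using inj_on_finite[OF inj sub] less.prems(2) by simp
    have "card ?N' \<le> card (?N - {\<alpha> s})" using card_inj_on_le[OF inj sub] less.prems(2) by simp
    also have "\<dots> < card ?N"
      using s less.prems(2) by (intro card_Diff1_less) (simp_all add: alpha_Pos)
    finally obtain w where w: "w \<in> carrier W" "\<forall>t\<in>S. 0 \<le> x (act s (act w (\<alpha> t)))"
      using less.hyps[of "\<lambda>v. x (act s v)"] lin_act less.prems(1) finN by blast
    then show ?thesis
      using s by (intro bexI[of _ "s \<otimes> w"]) (auto simp: act_mult S_carrier)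
  qed
qed

text \<open>A shortest \<open>w\<close> is taken so that the simple roots of the conjugated
  stabilizer go to positive roots; this is needed to compare them with canonical generators.\<close>

lemma to_dominant_minimal:
  assumes x: "x \<in> U"
  obtains w where "w \<in> carrier W" "\<And>s. s \<in> S \<Longrightarrow> 0 \<le> x (act w (\<alpha> s))"
    "\<And>s. s \<in> S \<Longrightarrow> x (act w (\<alpha> s)) = 0 \<Longrightarrow> nonneg (act w (\<alpha> s))"
proof -
  let ?D = "\<lambda>w. w \<in> carrier W \<and> (\<forall>s\<in>S. 0 \<le> x (act w (\<alpha> s)))"
  have lx: "lin x" using x by (simp add: U_def)
  have "finite {\<beta> \<in> Pos. x \<beta> < 0}"
    by (rule finite_subset[of _ "{\<beta> \<in> Pos. x \<beta> \<le> 0}"]) (use x in \<open>auto simp: U_def\<close>)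
  then have "\<exists>w. ?D w" using to_dominant lx by blast
  then obtain w where w: "?D w" and min: "\<And>w'. ?D w' \<Longrightarrow> len w \<le> len w'"
    using ex_has_least_nat[of ?D _ len] by blast
  have "nonneg (act w (\<alpha> s))" if s: "s \<in> S" "x (act w (\<alpha> s)) = 0" for s
  proof (rule act_alpha_nonneg)
    \<comment> \<open>The root \<open>act w (\<alpha> s)\<close> has value 0 under \<open>x\<close>,
      so appending \<open>s\<close> changes no value and \<open>w \<otimes> s\<close> competes with
      \<open>w\<close> for minimal length.\<close>
    have "0 \<le> x (act (w \<otimes> s) (\<alpha> t))" if "t \<in> S" for t
      using w s that lx by (simp add: act_mult S_carrier act_S sigma_lc act_lc linD)
    then show "len w \<le> len (w \<otimes> s)" using w s by (intro min) (auto simp: S_carrier)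
  qed (use w s in auto)
  with w that show ?thesis by blast
qed

lemma dominant_nonneg:
  assumes "lin y" "\<And>s. s \<in> S \<Longrightarrow> 0 \<le> y (\<alpha> s)" "v \<in> V" "nonneg v"
  shows "0 \<le> y v"
  unfolding lin_expand[OF assms(1,3)]
  using assms by (intro sum_nonneg mult_nonneg_nonneg) (auto simp: V_def)

text \<open>As \<open>k\<close> makes \<open>\<alpha> s\<close> nonpositive, dominance gives
  \<open>y (act k (\<alpha> s)) \<le> 0\<close>. Invariance identifies this value with
  \<open>y (\<alpha> s)\<close>, which is nonnegative.\<close>

lemma Stab_descent:
  assumes y: "lin y" "\<And>s. s \<in> S \<Longrightarrow> 0 \<le> y (\<alpha> s)"
    and k: "k \<in> Stab y" and s: "s \<in> S" "len (k \<otimes> s) < len k"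
  shows "y (\<alpha> s) = 0"
proof -
  have "\<forall>z. act k (\<alpha> s) z \<le> 0" using act_alpha_nonpos k s by (simp add: Stab_def)
  moreover have "(\<lambda>z. - act k (\<alpha> s) z) \<in> V" using act_V[of "\<alpha> s" k] s lc_V[of "act k (\<alpha> s)" "act k (\<alpha> s)" "-1" 0] by (simp add: lc_def)
  ultimately have "0 \<le> y (\<lambda>z. - act k (\<alpha> s) z)" using dominant_nonneg[OF y] by simp
  also have "\<dots> = - y (\<alpha> s)" using k s y by (simp add: lin_uminus Stab_def)
  finally show ?thesis using y(2)[OF s(1)] by simp
qed

lemma Stab_dominant_generate:
  assumes y: "lin y" "\<And>s. s \<in> S \<Longrightarrow> 0 \<le> y (\<alpha> s)"
  shows "k \<in> Stab y \<Longrightarrow> k \<in> generate W {s \<in> S. y (\<alpha> s) = 0}"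
proof (induction "len k" arbitrary: k rule: less_induct)
  case (less k)
  have k: "k \<in> carrier W" using less.prems by (simp add: Stab_def)
  show ?case
  proof (cases "k = \<one>")
    case False
    then obtain s where s: "s \<in> S" "len (k \<otimes> s) < len k" using ex_descent k by blast
    have ys: "y (\<alpha> s) = 0" using Stab_descent y less.prems s by blast
    have "s \<in> Stab y" using s ys y by (auto simp: Stab_def S_carrier act_S sigma_lc linD)
    then have "k \<otimes> s \<in> Stab y" using subgroup.m_closed[OF Stab_subgroup less.prems] by blast
    then have "k \<otimes> s \<otimes> s \<in> generate W {s \<in> S. y (\<alpha> s) = 0}"
      using less.hyps s ys by (blast intro: generate.eng generate.incl)
    then show ?thesis using mult_S_S k s by simp
  qed (simp add: generate.one)
qed

text \<open>An element of the stabilizer is determined by the images of the simple roots killed by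
  \<open>y\<close>. These are roots killed by \<open>y\<close>, of which there are finitely
  many.\<close>

lemma finite_Stab_dominant:
  assumes y: "y \<in> U" "\<And>s. s \<in> S \<Longrightarrow> 0 \<le> y (\<alpha> s)"
  shows "finite (Stab y)"
proof -
  let ?I = "{s \<in> S. y (\<alpha> s) = 0}" and ?Z = "{\<beta> \<in> Pos. y \<beta> \<le> 0}" and ?R = "{\<beta> \<in> roots W S. y \<beta> = 0}"
  have ly: "lin y" and finZ: "finite ?Z" using y(1) by (auto simp: U_def)
  have "?R \<subseteq> ?Z \<union> (\<lambda>\<beta> x. - \<beta> x) ` ?Z"
  proof
    fix \<beta> assume b: "\<beta> \<in> ?R"
    show "\<beta> \<in> ?Z \<union> (\<lambda>\<beta> x. - \<beta> x) ` ?Z"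
    proof (cases "nonneg \<beta>")
      case False
      then have "(\<lambda>x. - \<beta> x) \<in> ?Z"
        using b roots_sign[of \<beta>] roots_uminus ly by (auto simp: Pos_iff lin_uminus)
      then show ?thesis by (intro UnI2 image_eqI[of _ _ "\<lambda>x. - \<beta> x"]) auto
    qed (use b in \<open>auto simp: Pos_iff\<close>)
  qed
  then have finR: "finite ?R" using finZ by (auto intro: finite_subset)
  have "inj_on \<alpha> ?I" by (rule inj_onI) (metis simple_root_def zero_neq_one)
  moreover have "\<alpha> ` ?I \<subseteq> ?Z" using alpha_Pos by auto
  ultimately have finI: "finite ?I" using finZ by (rule inj_on_finite)
  have "(\<lambda>k. \<lambda>s\<in>?I. act k (\<alpha> s)) ` Stab y \<subseteq> ?I \<rightarrow>\<^sub>E ?R"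
    by (auto simp: Stab_def roots_act alpha_roots)
  moreover have "inj_on (\<lambda>k. \<lambda>s\<in>?I. act k (\<alpha> s)) (Stab y)"
  proof (rule inj_onI)
    fix k k' assume k: "k \<in> Stab y" "k' \<in> Stab y"
      and eq: "(\<lambda>s\<in>?I. act k (\<alpha> s)) = (\<lambda>s\<in>?I. act k' (\<alpha> s))"
    let ?j = "inv k' \<otimes> k"
    have kc: "k \<in> carrier W" "k' \<in> carrier W" using k by (auto simp: Stab_def)
    have j: "?j \<in> Stab y"
      using k by (meson Stab_subgroup subgroup.m_closed subgroup.m_inv_closed)
    \<comment> \<open>A descent of \<open>?j\<close> would lie in \<open>?I\<close>, but
      \<open>?j\<close> fixes the simple roots there instead of making them nonpositive.\<close>
    have "?j = \<one>"
    proof (rule ccontr)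
      assume "?j \<noteq> \<one>"
      then obtain s where s: "s \<in> S" "len (?j \<otimes> s) < len ?j" using ex_descent[of ?j] kc by auto
      then have sI: "s \<in> ?I" using Stab_descent[OF ly y(2) j] by simp
      then have "act k (\<alpha> s) = act k' (\<alpha> s)" using fun_cong[OF eq, of s] by simp
      then have "act ?j (\<alpha> s) = \<alpha> s" using kc s by (simp add: act_mult act_inv_act)
      then show False using act_alpha_nonpos[of ?j s] s kc
        by (metis inv_closed m_closed not_one_le_zero simple_root_def)
    qed
    then show "k = k'" using kc by (metis inv_closed inv_equality inv_inv)
  qed
  ultimately show ?thesis using finI finR by (meson finite_PiE inj_on_finite)
qed

section \<open>Parabolic closures of finite subgroups\<close>

lemma mult_inv_cancel:
  "w \<in> carrier W \<Longrightarrow> z \<in> carrier W \<Longrightarrow> w \<otimes> (inv w \<otimes> z) = z"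
  "w \<in> carrier W \<Longrightarrow> z \<in> carrier W \<Longrightarrow> inv w \<otimes> (w \<otimes> z) = z"
  by (simp_all add: m_assoc[symmetric])

lemma generate_conj:
  assumes w: "w \<in> carrier W" and I: "I \<subseteq> carrier W" and k: "k \<in> generate W I"
  shows "w \<otimes> k \<otimes> inv w \<in> generate W ((\<lambda>s. w \<otimes> s \<otimes> inv w) ` I)"
  using k
proof (induction rule: generate.induct)
  case one
  then show ?case using w by (simp add: generate.one)
next
  case (incl h)
  then show ?case by (blast intro: generate.incl)
next
  case (inv h)
  then have "inv (w \<otimes> h \<otimes> inv w) \<in> generate W ((\<lambda>s. w \<otimes> s \<otimes> inv w) ` I)"
    by (blast intro: generate.inv)
  then show ?case using inv w I by (simp add: inv_mult_group m_assoc subset_iff)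
next
  case (eng h1 h2)
  then have h: "h1 \<in> carrier W" "h2 \<in> carrier W" using generate_in_carrier[OF I] by auto
  have "(w \<otimes> h1 \<otimes> inv w) \<otimes> (w \<otimes> h2 \<otimes> inv w) = w \<otimes> (h1 \<otimes> h2) \<otimes> inv w"
    using h w by (simp add: m_assoc mult_inv_cancel)
  then show ?case using eng.IH by (metis generate.eng)
qed

definition simple_conj :: "'a \<Rightarrow> 'a set \<Rightarrow> 'a set" where
  "simple_conj w I = (\<lambda>s. w \<otimes> s \<otimes> inv w) ` I"

text \<open>Pulled back by \<open>w\<close>, a canonical root is a nonnegative combination of simple
  roots \<open>\<alpha> s\<close> with \<open>x (act w (\<alpha> s)) = 0\<close>. Their images are
  positive roots of \<open>Stab x\<close>, so indecomposability forces the canonical root to be one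
  of these images.\<close>

lemma canon_gens_subset:
  assumes x: "lin x" and w: "w \<in> carrier W"
    and dom: "\<And>s. s \<in> S \<Longrightarrow> 0 \<le> x (act w (\<alpha> s))"
    and min: "\<And>s. s \<in> S \<Longrightarrow> x (act w (\<alpha> s)) = 0 \<Longrightarrow> nonneg (act w (\<alpha> s))"
  shows "canon_gens W S (Stab x) \<subseteq> simple_conj w {s \<in> S. x (act w (\<alpha> s)) = 0}"
proof
  fix r assume "r \<in> canon_gens W S (Stab x)"
  then obtain \<gamma> where \<gamma>: "\<gamma> \<in> pos_roots_of W S (Stab x)" "r = root_refl W S \<gamma>"
    and indec: "\<not> pos_lin_comb (pos_roots_of W S (Stab x) - {\<gamma>}) \<gamma>"
    by (auto simp: canon_gens_def Pi_G_def)
  have \<gamma>P: "\<gamma> \<in> roots W S" "nonneg \<gamma>" "x \<gamma> = 0"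
    using \<gamma>(1) refl_in_Stab[OF x] by (auto simp: pos_roots_of_def Pos_iff)
  define \<beta> where "\<beta> = act (inv w) \<gamma>"
  have \<beta>: "\<beta> \<in> roots W S" "act w \<beta> = \<gamma>"
    using \<gamma>P w by (simp_all add: \<beta>_def roots_act act_act_inv)
  then have \<beta>V: "\<beta> \<in> V" by simp
  let ?T = "{s. \<beta> s \<noteq> 0}"
  have T: "finite ?T" "?T \<subseteq> S" using \<beta>V by (auto simp: V_def)
  \<comment> \<open>This is \<open>x \<gamma> = 0\<close> expanded over simple roots. All terms have
    the same sign, so each of them vanishes.\<close>
  have "0 = (\<Sum>s\<in>?T. \<beta> s * x (act w (\<alpha> s)))"
    using lin_expand[OF lin_act[OF x] \<beta>V, of w] \<beta> \<gamma>P by simp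
  then have sum0: "(\<Sum>s\<in>?T. \<beta> s * x (act w (\<alpha> s))) = 0" "(\<Sum>s\<in>?T. - \<beta> s * x (act w (\<alpha> s))) = 0"
    by (simp_all add: sum_negf)
  have "\<forall>s\<in>?T. \<beta> s * x (act w (\<alpha> s)) = 0"
    using roots_sign[OF \<beta>(1)]
  proof
    assume "nonneg \<beta>"
    then have "0 \<le> \<beta> s * x (act w (\<alpha> s))" if "s \<in> ?T" for s using dom T(2) that by auto
    then show ?thesis
      using sum_nonneg_eq_0_iff[OF T(1), of "\<lambda>s. \<beta> s * x (act w (\<alpha> s))"] sum0(1) by blast
  next
    assume "nonneg (\<lambda>x. - \<beta> x)"
    then have "0 \<le> - \<beta> s * x (act w (\<alpha> s))" if "s \<in> ?T" for s
      using dom T(2) that by (intro mult_nonneg_nonneg) auto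
    then show ?thesis
      using sum_nonneg_eq_0_iff[OF T(1), of "\<lambda>s. - \<beta> s * x (act w (\<alpha> s))"] sum0(2) by simp
  qed
  then have TI: "x (act w (\<alpha> s)) = 0" "s \<in> S" if "s \<in> ?T" for s using that T(2) by auto
  have \<gamma>_eq: "\<gamma> z = (\<Sum>s\<in>?T. \<beta> s * act w (\<alpha> s) z)" for z
    using lin_expand[OF lin_act_coord \<beta>V, of w z] \<beta> by simp
  have "nonneg \<beta>"
  proof (rule ccontr)
    assume "\<not> ?thesis"
    then have "\<forall>z. \<beta> z \<le> 0" using roots_sign[OF \<beta>(1)] by auto
    then have "\<gamma> z \<le> 0" for z
      unfolding \<gamma>_eq using min TI by (intro sum_nonpos) (simp add: mult_nonpos_nonneg)
    then have "\<gamma> z = 0" for z using \<gamma>P(2) by (simp add: order.antisym)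
    then show False using roots_nonzero \<gamma>P(1) by blast
  qed
  then have \<beta>pos: "0 < \<beta> s" if "s \<in> ?T" for s using that by (simp add: order.strict_iff_order)
  let ?F = "(\<lambda>s. act w (\<alpha> s)) ` ?T"
  have inj: "inj_on (\<lambda>s. act w (\<alpha> s)) ?T"
  proof (rule inj_onI)
    fix s t assume st: "s \<in> ?T" "t \<in> ?T" "act w (\<alpha> s) = act w (\<alpha> t)"
    then have "\<alpha> s = \<alpha> t" using act_inj_on[OF w] TI(2) by (auto dest: inj_onD)
    then show "s = t" by (metis simple_root_def zero_neq_one)
  qed
  have "\<gamma> \<in> ?F"
  proof (rule ccontr)
    assume nF: "\<gamma> \<notin> ?F"
    have "act w (\<alpha> s) \<in> pos_roots_of W S (Stab x)" if "s \<in> ?T" for s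
      using TI[OF that] min refl_in_Stab[OF x] roots_act[OF w] alpha_roots
      by (simp add: pos_roots_of_def Pos_iff)
    then have "?F \<subseteq> pos_roots_of W S (Stab x) - {\<gamma>}" using nF by auto
    moreover have "?F \<noteq> {}" using roots_nonzero[OF \<beta>(1)] by auto
    \<comment> \<open>In \<open>pos_lin_comb\<close> the coefficients are indexed by vectors, so the
      coordinate of \<open>\<beta>\<close> is recovered through the inverse of the injection
      \<open>inj\<close>.\<close>
    moreover have "\<gamma> = (\<lambda>z. \<Sum>b\<in>?F. \<beta> (the_inv_into ?T (\<lambda>s. act w (\<alpha> s)) b) * b z)"
      by (rule HOL.ext) (simp add: \<gamma>_eq sum.reindex[OF inj] the_inv_into_f_f[OF inj] del: mem_Collect_eq)
    moreover have "\<forall>b\<in>?F. 0 < \<beta> (the_inv_into ?T (\<lambda>s. act w (\<alpha> s)) b)"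
      using \<beta>pos by (auto simp: the_inv_into_f_f[OF inj] simp del: mem_Collect_eq)
    ultimately have "pos_lin_comb (pos_roots_of W S (Stab x) - {\<gamma>}) \<gamma>"
      unfolding pos_lin_comb_def using T(1)
      by (intro exI[of _ ?F] exI[of _ "\<lambda>b. \<beta> (the_inv_into ?T (\<lambda>s. act w (\<alpha> s)) b)"] conjI) auto
    with indec show False ..
  qed
  then obtain s where s: "s \<in> ?T" "\<gamma> = act w (\<alpha> s)" by blast
  then have "r = w \<otimes> s \<otimes> inv w" using \<gamma>(2) w TI(2) by (simp add: root_refl_act)
  then show "r \<in> simple_conj w {s \<in> S. x (act w (\<alpha> s)) = 0}"
    unfolding simple_conj_def using TI[OF s(1)] by blast
qed

lemma Stab_structure:
  assumes x: "x \<in> U"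
  shows "\<exists>w\<in>carrier W. \<exists>I\<subseteq>S. Stab x \<subseteq> generate W (simple_conj w I) \<and> finite (Stab x)
    \<and> canon_gens W S (Stab x) \<subseteq> simple_conj w I
    \<and> (\<forall>s\<in>I. act w (\<alpha> s) \<in> Pos \<and> x (act w (\<alpha> s)) = 0)"
proof -
  obtain w where w: "w \<in> carrier W" and dom: "\<And>s. s \<in> S \<Longrightarrow> 0 \<le> x (act w (\<alpha> s))"
    and min: "\<And>s. s \<in> S \<Longrightarrow> x (act w (\<alpha> s)) = 0 \<Longrightarrow> nonneg (act w (\<alpha> s))"
    using to_dominant_minimal[OF x] by blast
  have lx: "lin x" using x by (simp add: U_def)
  let ?y = "\<lambda>v. x (act w v)" and ?I = "{s \<in> S. x (act w (\<alpha> s)) = 0}"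
  have conj: "inv w \<otimes> h \<otimes> w \<in> Stab ?y \<and> h = w \<otimes> (inv w \<otimes> h \<otimes> w) \<otimes> inv w" if "h \<in> Stab x" for h
  proof
    have h: "h \<in> carrier W" "\<And>v. v \<in> V \<Longrightarrow> x (act h v) = x v" using that by (auto simp: Stab_def)
    then show "inv w \<otimes> h \<otimes> w \<in> Stab ?y"
      using w by (auto simp: Stab_def act_mult act_act_inv)
    show "h = w \<otimes> (inv w \<otimes> h \<otimes> w) \<otimes> inv w"
      using w h by (simp add: m_assoc mult_inv_cancel)
  qed
  show ?thesis
  proof (intro bexI[OF _ w] exI[of _ ?I] conjI)
    show "Stab x \<subseteq> generate W (simple_conj w ?I)"
    proof
      fix h assume h: "h \<in> Stab x"
      have "inv w \<otimes> h \<otimes> w \<in> generate W ?I"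
        using Stab_dominant_generate[OF lin_act[OF lx] dom] conj[OF h] by simp
      then have "w \<otimes> (inv w \<otimes> h \<otimes> w) \<otimes> inv w \<in> generate W (simple_conj w ?I)"
        unfolding simple_conj_def by (intro generate_conj w) (auto simp: S_carrier)
      then show "h \<in> generate W (simple_conj w ?I)" using conj[OF h] by simp
    qed
    have "Stab x \<subseteq> (\<lambda>k. w \<otimes> k \<otimes> inv w) ` Stab ?y" using conj by blast
    moreover have "finite (Stab ?y)" using finite_Stab_dominant[OF U_act[OF x w]] dom by simp
    ultimately show "finite (Stab x)" by (auto intro: finite_subset)
    show "canon_gens W S (Stab x) \<subseteq> simple_conj w ?I"
      using canon_gens_subset[OF lx w dom min] by blast
    show "\<forall>s\<in>?I. act w (\<alpha> s) \<in> Pos \<and> x (act w (\<alpha> s)) = 0"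
      using min roots_act[OF w] alpha_roots by (auto simp: Pos_iff)
  qed auto
qed

text \<open>The stabilizer of a point of \<open>U\<close> is generated by reflections in walls
  through it, so an inclusion of walls gives an inclusion of stabilizers.\<close>

lemma Stab_subset_Stab:
  assumes x: "x \<in> U" and y: "lin y" and sub: "\<And>\<beta>. \<beta> \<in> Pos \<Longrightarrow> x \<beta> = 0 \<Longrightarrow> y \<beta> = 0"
  shows "Stab x \<subseteq> Stab y"
proof -
  obtain w I where w: "w \<in> carrier W" "I \<subseteq> S" "Stab x \<subseteq> generate W (simple_conj w I)"
    and I: "\<And>s. s \<in> I \<Longrightarrow> act w (\<alpha> s) \<in> Pos \<and> x (act w (\<alpha> s)) = 0"
    using Stab_structure[OF x] by blast
  have "w \<otimes> s \<otimes> inv w \<in> Stab y" if "s \<in> I" for s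
    using refl_in_Stab[OF y, of "act w (\<alpha> s)"] sub I[OF that] w that
    by (auto simp: root_refl_act Pos_iff subset_iff)
  then have "simple_conj w I \<subseteq> Stab y" by (auto simp: simple_conj_def)
  then show ?thesis using w(3) generate_subgroup_incl[OF _ Stab_subgroup] by blast
qed

text \<open>Averaging the sum of coordinates over a finite subgroup gives a fixed point.\<close>

lemma finite_subgroup_fixed_point:
  assumes F: "subgroup F W" "finite F"
  obtains x where "x \<in> U" "F \<subseteq> Stab x"
proof -
  have FW: "F \<subseteq> carrier W" using F(1) by (rule subgroup.subset)
  define p :: "('a \<Rightarrow> real) \<Rightarrow> real" where "p = (\<lambda>v. \<Sum>s | v s \<noteq> 0. v s)"
  have p_sup: "p v = sum v A" if "finite A" "{s. v s \<noteq> 0} \<subseteq> A" for v A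
    unfolding p_def using that by (intro sum.mono_neutral_left) auto
  have lin_p: "lin p" unfolding lin_def
  proof (intro ballI allI)
    fix u v a b assume uv: "u \<in> V" "v \<in> V"
    let ?A = "{x. u x \<noteq> 0} \<union> {x. v x \<noteq> 0}"
    have A: "finite ?A" using uv by (auto simp: V_def)
    have "p (lc a u b v) = sum (lc a u b v) ?A" by (rule p_sup[OF A]) (auto simp: lc_def)
    also have "\<dots> = a * sum u ?A + b * sum v ?A"
      by (simp add: lc_def sum.distrib sum_distrib_left)
    also have "\<dots> = a * p u + b * p v" using p_sup[OF A, of u] p_sup[OF A, of v] by auto
    finally show "p (lc a u b v) = a * p u + b * p v" .
  qed
  have p_pos: "p \<beta> > 0" if "\<beta> \<in> Pos" for \<beta>
  proof -
    have "\<beta> \<in> V" "nonneg \<beta>" "\<exists>x. \<beta> x \<noteq> 0" using that roots_nonzero by (auto simp: Pos_iff)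
    then show ?thesis unfolding p_def
      by (intro sum_pos) (auto simp: V_def order.strict_iff_order)
  qed
  define x where "x = (\<lambda>v. \<Sum>f\<in>F. p (act f v))"
  have lin_x: "lin x" unfolding lin_def x_def
    using lin_act[OF lin_p] by (simp add: lin_def sum.distrib sum_distrib_left)
  \<comment> \<open>If no element of \<open>F\<close> makes \<open>\<beta>\<close> negative, every
    summand of \<open>x \<beta>\<close> is positive; only inversions of the finitely many elements
    of \<open>F\<close> remain.\<close>
  have "{\<beta> \<in> Pos. x \<beta> \<le> 0} \<subseteq> (\<Union>f\<in>F. {\<beta> \<in> Pos. \<not> nonneg (act f \<beta>)})"
  proof (rule subsetI, rule ccontr)
    fix \<beta> assume b: "\<beta> \<in> {\<beta> \<in> Pos. x \<beta> \<le> 0}" "\<beta> \<notin> (\<Union>f\<in>F. {\<beta> \<in> Pos. \<not> nonneg (act f \<beta>)})"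
    then have "act f \<beta> \<in> Pos" if "f \<in> F" for f
      using that roots_act FW by (auto simp: Pos_iff subset_iff)
    then have "0 < x \<beta>" unfolding x_def
      using p_pos F subgroup.one_closed[OF F(1)] by (intro sum_pos) auto
    then show False using b by simp
  qed
  then have "finite {\<beta> \<in> Pos. x \<beta> \<le> 0}"
    by (rule finite_subset) (use F(2) FW finite_inversions in blast)
  then have "x \<in> U" using lin_x by (simp add: U_def)
  moreover have "F \<subseteq> Stab x"
  proof
    fix g assume g: "g \<in> F"
    have "x (act g v) = x v" if v: "v \<in> V" for v
    proof -
      have "x (act g v) = (\<Sum>f\<in>F. p (act (f \<otimes> g) v))"
        unfolding x_def using g v FW by (intro sum.cong) (auto simp: act_mult subset_iff)
      also have "\<dots> = x v" unfolding x_def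
      \<comment> \<open>Right translation by \<open>g\<close> permutes \<open>F\<close>.\<close>
      proof (rule sum.reindex_bij_witness[of _ "\<lambda>f. f \<otimes> inv g" "\<lambda>f. f \<otimes> g"])
        fix f assume f: "f \<in> F"
        have "f \<in> carrier W" "g \<in> carrier W" using f g FW by auto
        then show "f \<otimes> g \<otimes> inv g = f" "f \<otimes> inv g \<otimes> g = f"
          by (simp_all add: m_assoc)
        show "f \<otimes> g \<in> F" "f \<otimes> inv g \<in> F"
          using f g F(1) by (simp_all add: subgroup.m_closed subgroup.m_inv_closed)
      qed simp
      finally show ?thesis .
    qed
    then show "g \<in> Stab x" using g FW by (auto simp: Stab_def)
  qed
  ultimately show ?thesis using that by blast
qed

text \<open>For finite \<open>E\<close> generating a finite group, this is the parabolic closure of \<open>E\<close>.\<close>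

definition PC :: "'a set \<Rightarrow> 'a set" where
  "PC E = {h \<in> carrier W. \<forall>x\<in>U. E \<subseteq> Stab x \<longrightarrow> h \<in> Stab x}"

lemma PC_mono: "E \<subseteq> E' \<Longrightarrow> PC E \<subseteq> PC E'"
  unfolding PC_def by blast

lemma subset_PC: "E \<subseteq> carrier W \<Longrightarrow> E \<subseteq> PC E"
  unfolding PC_def by blast

text \<open>A fixed point on as few walls as possible has the smallest stabilizer: otherwise a generic
  point of the segment towards another fixed point would lie on fewer walls.\<close>

lemma PC_eq_Stab:
  assumes E: "E \<subseteq> carrier W" "finite (generate W E)"
  obtains x where "x \<in> U" "PC E = Stab x"
proof -
  let ?Z = "\<lambda>x. {\<beta> \<in> Pos. x \<beta> = 0}"
  let ?P = "\<lambda>x. x \<in> U \<and> E \<subseteq> Stab x"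
  obtain x0 where "x0 \<in> U" "generate W E \<subseteq> Stab x0"
    using finite_subgroup_fixed_point[OF generate_is_subgroup[OF E(1)] E(2)] by blast
  moreover have "E \<subseteq> generate W E" by (auto intro: generate.incl)
  ultimately have "?P x0" by blast
  then obtain x where x: "?P x" and min: "\<And>y. ?P y \<Longrightarrow> card (?Z x) \<le> card (?Z y)"
    using ex_has_least_nat[of ?P _ "\<lambda>x. card (?Z x)"] by blast
  have lx: "lin x" using x by (simp add: U_def)
  have "Stab x \<subseteq> Stab y" if y: "?P y" for y
  proof (rule Stab_subset_Stab)
    show ly: "lin y" using y by (simp add: U_def)
    let ?T = "{\<beta> \<in> Pos. x \<beta> \<le> 0} \<union> {\<beta> \<in> Pos. y \<beta> \<le> 0}"
    have finT: "finite ?T" using x y by (simp add: U_def)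
    \<comment> \<open>These are the parameters at which \<open>x + c * y\<close> can acquire a wall
      not containing \<open>y\<close>, and \<open>c\<close> is chosen beyond all of them. Inserting
      0 makes \<open>c\<close> positive and the maximum one of a nonempty set; where
      \<open>y \<beta> = 0\<close>, division by zero merely contributes 0.\<close>
    define K where "K = (\<lambda>\<beta>. - x \<beta> / y \<beta>) ` ?T"
    define c where "c = Max (insert 0 K) + 1"
    have finK: "finite (insert 0 K)" using finT by (simp add: K_def)
    have le: "k < c" if "k \<in> insert 0 K" for k
      using Max_ge[OF finK that] by (simp add: c_def)
    have c: "c > 0" "c \<notin> K" using le by auto
    define z where "z = (\<lambda>v. x v + c * y v)"
    have lz: "lin z" using lx ly unfolding lin_def z_def by (simp add: algebra_simps)
    have pos: "0 < z \<beta>" if "\<beta> \<in> Pos" "\<beta> \<notin> ?T" for \<beta>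
      using that c unfolding z_def by (auto intro!: add_pos_pos)
    have "{\<beta> \<in> Pos. z \<beta> \<le> 0} \<subseteq> ?T"
    proof (rule subsetI, rule ccontr)
      fix \<beta> assume b: "\<beta> \<in> {\<beta> \<in> Pos. z \<beta> \<le> 0}" "\<beta> \<notin> ?T"
      from b(1) have "\<beta> \<in> Pos" "z \<beta> \<le> 0" by simp_all
      with pos[OF _ b(2)] show False by (simp add: not_less[symmetric])
    qed
    then have "z \<in> U" using lz finT by (auto simp: U_def intro: finite_subset)
    moreover have "E \<subseteq> Stab z" using x y by (auto simp: Stab_def z_def subset_iff)
    ultimately have card: "card (?Z x) \<le> card (?Z z)" using min by blast
    have Zz: "x \<beta> = 0 \<and> y \<beta> = 0" if b: "\<beta> \<in> Pos" "z \<beta> = 0" for \<beta>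
    proof -
      have T: "\<beta> \<in> ?T" using pos[OF b(1)] b(2) by (metis less_irrefl)
      have "y \<beta> = 0"
      proof (rule ccontr)
        assume "y \<beta> \<noteq> 0"
        then have "c = - x \<beta> / y \<beta>" using b(2) by (simp add: z_def field_simps)
        then show False using T c(2) unfolding K_def by blast
      qed
      then show ?thesis using b(2) by (simp add: z_def)
    qed
    have "finite (?Z x)"
      by (rule finite_subset[OF _ finT]) auto
    moreover have "?Z z \<subseteq> ?Z x" using Zz by auto
    \<comment> \<open>Minimality of \<open>x\<close> permits no loss of walls, and walls of
      \<open>z\<close> contain both \<open>x\<close> and \<open>y\<close>; so every wall of
      \<open>x\<close> contains \<open>y\<close>.\<close>
    ultimately have "?Z z = ?Z x" using card by (intro card_seteq)
    then show "y \<beta> = 0" if "\<beta> \<in> Pos" "x \<beta> = 0" for \<beta> using that Zz by blast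
  qed (use x in blast)
  then have "PC E = Stab x" using x unfolding PC_def Stab_def by blast
  with x that show ?thesis by blast
qed

text \<open>A smaller subgroup has fewer roots, hence fewer possible decompositions.\<close>

lemma Pi_G_antimono:
  assumes "P \<subseteq> H" "\<gamma> \<in> Pi_G W S H" "root_refl W S \<gamma> \<in> P"
  shows "\<gamma> \<in> Pi_G W S P"
proof -
  have "pos_roots_of W S P \<subseteq> pos_roots_of W S H" using assms(1) by (auto simp: pos_roots_of_def)
  then have "\<not> pos_lin_comb (pos_roots_of W S P - {\<gamma>}) \<gamma>"
    using assms(2) unfolding Pi_G_def pos_lin_comb_def by blast
  then show ?thesis using assms(2,3) by (auto simp: Pi_G_def pos_roots_of_def)
qed

section \<open>The directed union of the parabolic closures\<close>

lemma directed_finite_subset: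
  assumes "finite F" "F \<subseteq> (\<Union>E\<in>{E. finite E \<and> E \<subseteq> G}. PC E)"
  shows "\<exists>E. finite E \<and> E \<subseteq> G \<and> F \<subseteq> PC E"
  using assms
proof (induction F rule: finite_induct)
  case (insert h F)
  then obtain E E' where "finite E" "E \<subseteq> G" "F \<subseteq> PC E" "finite E'" "E' \<subseteq> G" "h \<in> PC E'" by auto
  then show ?case
    using PC_mono[of E "E \<union> E'"] PC_mono[of E' "E \<union> E'"] by (intro exI[of _ "E \<union> E'"]) auto
qed auto

lemma locally_finite_hull:
  assumes G: "subgroup G W" "locally_finite W G"
  shows "\<exists>H. subgroup H W \<and> locally_finite W H \<and> locally_parabolic W S H \<and> G \<subseteq> H"
proof -
  define H where "H = (\<Union>E\<in>{E. finite E \<and> E \<subseteq> G}. PC E)"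
  have GW: "G \<subseteq> carrier W" using G(1) by (rule subgroup.subset)
  have PC: "\<exists>x\<in>U. PC E = Stab x" if "finite E" "E \<subseteq> G" for E
  proof -
    have "finite (generate W E)" using G(2) that by (simp add: locally_finite_def)
    moreover have "E \<subseteq> carrier W" using that GW by blast
    ultimately show ?thesis using PC_eq_Stab by metis
  qed
  \<comment> \<open>All properties of \<open>H\<close> below concern finitely many elements at a
    time, so each is checked inside a single finite stabilizer contained in
    \<open>H\<close>.\<close>
  have dir: "\<exists>x\<in>U. F \<subseteq> Stab x \<and> Stab x \<subseteq> H" if F: "finite F" "F \<subseteq> H" for F
  proof -
    obtain E where E: "finite E" "E \<subseteq> G" "F \<subseteq> PC E"
      using directed_finite_subset[OF F(1) F(2)[unfolded H_def]] by blast
    then have "PC E \<subseteq> H" unfolding H_def by blast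
    moreover obtain x where "x \<in> U" "PC E = Stab x" using PC[OF E(1,2)] by blast
    ultimately show ?thesis using E(3) by (intro bexI[of _ x]) simp_all
  qed
  have HW: "H \<subseteq> carrier W" by (auto simp: H_def PC_def)
  have GH: "G \<subseteq> H"
  proof
    fix g assume g: "g \<in> G"
    then have "g \<in> PC {g}" using subset_PC[of "{g}"] GW by auto
    then show "g \<in> H" unfolding H_def using g by blast
  qed
  have H: "subgroup H W"
  proof
    show "\<one> \<in> H" using GH subgroup.one_closed[OF G(1)] by blast
    fix h assume h: "h \<in> H"
    then show "inv h \<in> H"
      using dir[of "{h}"] subgroup.m_inv_closed[OF Stab_subgroup] by blast
    fix k assume "k \<in> H"
    with h obtain x where "{h, k} \<subseteq> Stab x" "Stab x \<subseteq> H" using dir[of "{h, k}"] by auto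
    then show "h \<otimes> k \<in> H" using subgroup.m_closed[OF Stab_subgroup] by blast
  qed (use HW in auto)
  have fin: "locally_finite W H" unfolding locally_finite_def
  proof (intro allI impI)
    fix F assume "finite F \<and> F \<subseteq> H"
    then obtain x where x: "x \<in> U" "F \<subseteq> Stab x" using dir by blast
    have "generate W F \<subseteq> Stab x" by (rule generate_subgroup_incl[OF x(2) Stab_subgroup])
    moreover have "finite (Stab x)" using Stab_structure[OF x(1)] by blast
    ultimately show "finite (generate W F)" by (rule finite_subset)
  qed
  have "generate W (reflections W S \<inter> H) = H"
  proof
    show "generate W (reflections W S \<inter> H) \<subseteq> H" by (intro generate_subgroup_incl H) auto
    show "H \<subseteq> generate W (reflections W S \<inter> H)"
    proof
      fix h assume "h \<in> H"
      then obtain x where x: "x \<in> U" "h \<in> Stab x" "Stab x \<subseteq> H" using dir[of "{h}"] by auto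
      then have lx: "lin x" by (simp add: U_def)
      obtain w I where w: "w \<in> carrier W" "I \<subseteq> S" "Stab x \<subseteq> generate W (simple_conj w I)"
        and I: "\<And>s. s \<in> I \<Longrightarrow> act w (\<alpha> s) \<in> Pos \<and> x (act w (\<alpha> s)) = 0"
        using Stab_structure[OF x(1)] by blast
      have "simple_conj w I \<subseteq> reflections W S \<inter> H"
      proof
        fix r assume "r \<in> simple_conj w I"
        then obtain s where s: "s \<in> I" "r = w \<otimes> s \<otimes> inv w" by (auto simp: simple_conj_def)
        then have "r = root_refl W S (act w (\<alpha> s))" using w root_refl_act by auto
        then show "r \<in> reflections W S \<inter> H"
          using I[OF s(1)] refl_in_Stab[OF lx] root_refl_roots(1) x(3) by (auto simp: Pos_iff)
      qed
      then have "generate W (simple_conj w I) \<subseteq> generate W (reflections W S \<inter> H)"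
        by (rule mono_generate)
      then show "h \<in> generate W (reflections W S \<inter> H)" using w(3) x(2) by blast
    qed
  qed
  then have refl: "reflection_subgroup W S H" unfolding reflection_subgroup_def by blast
  have "\<exists>w\<in>carrier W. (\<lambda>x. w \<otimes> x \<otimes> inv w) ` F \<subseteq> S" if F: "finite F" "F \<subseteq> canon_gens W S H" for F
  proof -
    have "F \<subseteq> H" using F(2) by (auto simp: canon_gens_def Pi_G_def pos_roots_of_def)
    then obtain x where x: "x \<in> U" "F \<subseteq> Stab x" "Stab x \<subseteq> H" using dir F(1) by blast
    obtain w I where w: "w \<in> carrier W" "I \<subseteq> S" "canon_gens W S (Stab x) \<subseteq> simple_conj w I"
      using Stab_structure[OF x(1)] by blast
    have "F \<subseteq> canon_gens W S (Stab x)"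
    proof
      fix r assume r: "r \<in> F"
      then obtain \<gamma> where "\<gamma> \<in> Pi_G W S H" "r = root_refl W S \<gamma>"
        using F(2) by (auto simp: canon_gens_def)
      then show "r \<in> canon_gens W S (Stab x)"
        using Pi_G_antimono[OF x(3)] r x(2) by (auto simp: canon_gens_def)
    qed
    then have "F \<subseteq> simple_conj w I" using w by blast
    \<comment> \<open>The canonical generators in \<open>F\<close> are simple reflections conjugated
      by \<open>w\<close>, so the required simultaneous conjugator is \<open>inv w\<close>.\<close>
    moreover have "inv w \<otimes> (w \<otimes> s \<otimes> inv w) \<otimes> inv (inv w) = s" if "s \<in> S" for s
      using that w S_carrier by (simp add: m_assoc mult_inv_cancel)
    ultimately have "(\<lambda>x. inv w \<otimes> x \<otimes> inv (inv w)) ` F \<subseteq> S"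
      using w(2) by (fastforce simp: simple_conj_def)
    then show ?thesis using w(1) by blast
  qed
  then have "locally_parabolic W S H" using refl by (auto simp: locally_parabolic_def)
  then show ?thesis using H fin GH by blast
qed

end

lemma locally_finite_subset: "locally_finite W H \<Longrightarrow> K \<subseteq> H \<Longrightarrow> locally_finite W K"
  unfolding locally_finite_def by blast

theorem theorem5p4:
  fixes W :: "('a, 'b) monoid_scheme" and S :: "'a set" and G :: "'a set"
  assumes "coxeter_system W S"
    and "\<exists>r. well_order_on S r"
    and "subgroup G W"
    and "locally_finite W G"
  shows "locally_finite W (LP_closure W S G)
     \<and> (\<exists>H. subgroup H W \<and> locally_finite W H \<and> locally_parabolic W S H \<and> G \<subseteq> H)"
proof -
  interpret coxeter W S
    using assms(1) by (simp add: coxeter_def coxeter_axioms_def coxeter_system_def)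
  obtain H where H: "subgroup H W" "locally_finite W H" "locally_parabolic W S H" "G \<subseteq> H"
    using locally_finite_hull[OF assms(3,4)] by blast
  then have "LP_closure W S G \<subseteq> H" by (auto simp: LP_closure_def)
  then show ?thesis using H locally_finite_subset by blast
qed

end
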